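(* Consider a partition of $\Gamma$ as the union of countably many disjoint measurable sets $\Gamma_j$ ($j=1,\dots$). Then for all $\rho\in(0,1)$ and $\gamma\ge1$, $$\mathbf{E}_X\sum_j\pi(\Gamma_j|X)\inf_{p\in\mathrm{co}(\Gamma_j)}D_\rho^{\mathrm{Re}}(q\|p)\le\frac{(\gamma-\rho)\ln\sum_j\pi(\Gamma_j)^{(\gamma-1)/(\gamma-\rho)}-\gamma\ln\sum_j\pi(\Gamma_j)e^{-n\sup_{p\in\mathrm{co}(\Gamma_j)}D_{\mathrm{KL}}(q\|p)}}{\rho(1-\rho)n},$$ where $\mathrm{co}(\Gamma_j)$ is the convex hull of the densities in $\Gamma_j$, $\pi(\Gamma_j)=\int_{\Gamma_j}d\pi(\theta)$ is the prior probability of $\Gamma_j$, and $$\pi(\Gamma_j|X)=\frac{\int_{\Gamma_j}\prod_{i=1}^np(X_i|\theta)\,d\pi(\theta)}{\int_{\Gamma}\prod_{i=1}^np(X_i|\theta)\,d\pi(\theta)}$$ is the Bayesian posterior probability of $\Gamma_j$.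
   Context: $\mathcal{X}$ is a sample space with a measure $\mu$; $q$ is a probability density with respect to $\mu$ (the true density); $X=(X_1,\dots,X_n)$ are $n$ independent samples from $q$; $\mathbf{E}_X$ is expectation over $X$ and $\mathbf{E}_q$ expectation over a single $x\sim q$. $\{p(\cdot|\theta):\theta\in\Gamma\}$ is a family of probability densities with respect to $\mu$ ($q$ need not belong to it); the family is also denoted $\Gamma$, so a subset of $\Gamma$ is identified with the corresponding set of densities. $\pi$ is a probability measure (prior) on $\Gamma$ not depending on $X$. $D_{\mathrm{KL}}(q\|p)=\mathbf{E}_q\ln(q(x)/p(x))$ and, for $\rho\in(0,1)$, $D_\rho^{\mathrm{Re}}(q\|p)=-\frac{1}{\rho(1-\rho)}\ln\mathbf{E}_q\big(\frac{p(x)}{q(x)}\big)^\rho$. All quantities are assumed measurable, and the expressions appearing (in particular the posterior) are assumed to be well defined. *)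

theory Defs
  imports "HOL-Probability.Probability" "HOL-Library.Function_Algebras"
begin

text \<open>Functions form a real vector space under the pointwise operations, so that \<open>convex hull F\<close>
  is available for a set \<open>F\<close> of real functions, in particular for a set of densities.\<close>

instantiation "fun" :: (type, real_vector) real_vector
begin

definition scaleR_fun :: "real \<Rightarrow> ('a \<Rightarrow> 'b) \<Rightarrow> 'a \<Rightarrow> 'b" where
  "scaleR_fun c f = (\<lambda>x. c *\<^sub>R f x)"

instance
  by standard (simp_all add: scaleR_fun_def fun_eq_iff scaleR_add_right scaleR_add_left)

end

definition ln_ennreal :: "ennreal \<Rightarrow> ereal" where
  "ln_ennreal x = (if x = 0 then - \<infinity> else if x = \<top> then \<infinity> else ereal (ln (enn2real x)))"

definition exp_ereal :: "ereal \<Rightarrow> ennreal" where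
  "exp_ereal x = (if x = - \<infinity> then 0 else if x = \<infinity> then \<top> else ennreal (exp (real_of_ereal x)))"

text \<open>Expectation of an extended-real function as the integral of its positive part minus the
  integral of its negative part (\<open>e2ennreal\<close> sends negative values to 0). It is only meaningful if
  at least one of the two is finite.\<close>

definition expect :: "'a measure \<Rightarrow> ('a \<Rightarrow> ereal) \<Rightarrow> ereal" where
  "expect M f = enn2ereal (\<integral>\<^sup>+x. e2ennreal (f x) \<partial>M) - enn2ereal (\<integral>\<^sup>+x. e2ennreal (- f x) \<partial>M)"

definition prob_density :: "'a measure \<Rightarrow> ('a \<Rightarrow> real) \<Rightarrow> bool" where
  "prob_density \<mu> f \<longleftrightarrow>
     f \<in> borel_measurable \<mu> \<and> (\<forall>x\<in>space \<mu>. 0 \<le> f x) \<and> (\<integral>\<^sup>+x. ennreal (f x) \<partial>\<mu>) = 1"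

text \<open>Both divergences are extended-real valued. The library constant \<open>KL_divergence\<close> is real-valued,
  and is 0 where the true value is infinite. In \<open>KL_div\<close> the ratio at a point with \<open>q x > 0\<close> and
  \<open>p x = 0\<close> is \<open>\<top>\<close>, with logarithm \<open>\<infinity>\<close>; the negative part of the logarithm is at most \<open>p x / q x\<close>,
  hence it has finite expectation. Points with \<open>q x = 0\<close> carry no mass under the measure with density \<open>q\<close>.\<close>

definition KL_div :: "'a measure \<Rightarrow> ('a \<Rightarrow> real) \<Rightarrow> ('a \<Rightarrow> real) \<Rightarrow> ereal" where
  "KL_div \<mu> q p = expect (density \<mu> (\<lambda>x. ennreal (q x))) (\<lambda>x. ln_ennreal (ennreal (q x) / ennreal (p x)))"

definition renyi_div :: "real \<Rightarrow> 'a measure \<Rightarrow> ('a \<Rightarrow> real) \<Rightarrow> ('a \<Rightarrow> real) \<Rightarrow> ereal" where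
  "renyi_div \<rho> \<mu> q p =
     ereal (- 1 / (\<rho> * (1 - \<rho>))) * ln_ennreal (\<integral>\<^sup>+x. ennreal ((p x / q x) powr \<rho>) \<partial>density \<mu> (\<lambda>y. ennreal (q y)))"

definition likelihood :: "nat \<Rightarrow> ('t \<Rightarrow> 'a \<Rightarrow> real) \<Rightarrow> 't \<Rightarrow> (nat \<Rightarrow> 'a) \<Rightarrow> ennreal" where
  "likelihood n p \<theta> X = (\<Prod>i<n. ennreal (p \<theta> (X i)))"

definition posterior ::
    "nat \<Rightarrow> ('t \<Rightarrow> 'a \<Rightarrow> real) \<Rightarrow> 't measure \<Rightarrow> 't set \<Rightarrow> (nat \<Rightarrow> 'a) \<Rightarrow> ennreal" where
  "posterior n p \<pi> A X =
     (\<integral>\<^sup>+\<theta>\<in>A. likelihood n p \<theta> X \<partial>\<pi>) / (\<integral>\<^sup>+\<theta>. likelihood n p \<theta> X \<partial>\<pi>)"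

text \<open>The joint law of \<open>n\<close> independent samples with density \<open>q\<close>.\<close>

definition sample_law :: "nat \<Rightarrow> 'a measure \<Rightarrow> ('a \<Rightarrow> real) \<Rightarrow> (nat \<Rightarrow> 'a) measure" where
  "sample_law n \<mu> q = PiM {..<n} (\<lambda>_. density \<mu> (\<lambda>x. ennreal (q x)))"

end

theory Submission
  imports Defs
begin

text \<open>
  Write \<open>Q\<close> for the law with density \<open>q\<close>, \<open>h\<^sub>\<theta> = p\<^sub>\<theta> / q\<close> for the likelihood ratio, and \<open>N\<^sub>j(X)\<close> for the
  integral of \<open>h\<^sub>\<theta>(X\<^sub>1) \<cdots> h\<^sub>\<theta>(X\<^sub>n)\<close> over \<open>\<Gamma>\<^sub>j\<close> against the prior. With the evidence \<open>S = \<Sum>\<^sub>j N\<^sub>j\<close> the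
  posterior weights are \<open>w\<^sub>j = N\<^sub>j / S\<close>. Let \<open>P\<^sub>j\<close> be the prior mass of \<open>\<Gamma>\<^sub>j\<close>, \<open>c\<^sub>j = \<rho>(1 - \<rho>)n D\<^sub>j\<close> with
  \<open>D\<^sub>j\<close> the infimum of the Renyi divergence over the convex hull, \<open>K\<^sub>j\<close> the supremum of the
  Kullback-Leibler divergence, \<open>\<kappa> = (\<gamma> - 1)/(\<gamma> - \<rho>)\<close>, \<open>A = \<Sum>\<^sub>j P\<^sub>j\<^sup>\<kappa>\<close> and
  \<open>B = \<Sum>\<^sub>j P\<^sub>j exp(- n K\<^sub>j)\<close>. If \<open>A\<close> is infinite or \<open>B\<close> is zero, the right-hand side is
  infinite. Otherwise three moment bounds carry the proof.

  \<^item> \<open>E N\<^sub>j \<le> P\<^sub>j\<close>, because \<open>E\<^sub>Q h\<^sub>\<theta> \<le> 1\<close> (lemma \<open>evidence_mass\<close>).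

  \<^item> \<open>E N\<^sub>j\<^sup>\<rho> \<le> P\<^sub>j\<^sup>\<rho> exp(- c\<^sub>j)\<close> (lemma \<open>evidence_le_exp_renyi\<close>). Integrate out one observation at a
  time: given the others, the last factor is a mixture of the \<open>h\<^sub>\<theta>\<close> with \<open>\<theta> \<in> \<Gamma>\<^sub>j\<close>, so it costs
  at most the supremum of the affinities \<open>E\<^sub>Q (f/q)\<^sup>\<rho>\<close> over the convex hull. A general mixture is not a finite
  convex combination; \<open>concave_functional_of_mixture_le\<close> bridges this gap.

  \<^item> \<open>E ln S \<ge> ln B\<close> (lemma \<open>expected_log_evidence_ge_KL\<close>), the Gibbs variational principle with
  reference measure proportional to \<open>exp(- n K\<^sub>j)\<close> times the prior on \<open>\<Gamma>\<^sub>j\<close>.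

  They are combined through the identity, valid where \<open>w\<^sub>j > 0\<close>,
  \<open>w\<^sub>j (c\<^sub>j + \<gamma> ln S) = w\<^sub>j ln (u\<^sub>j / w\<^sub>j) + (\<gamma> - \<rho>) w\<^sub>j ln (v\<^sub>j / w\<^sub>j\<^sup>\<kappa>)\<close> with
  \<open>u\<^sub>j = exp(c\<^sub>j) P\<^sub>j\<^sup>1\<^sup>-\<^sup>\<rho> N\<^sub>j\<^sup>\<rho>\<close> and \<open>v\<^sub>j = P\<^sub>j\<^sup>\<kappa>\<^sup>-\<^sup>1 N\<^sub>j\<close>, whose sums over \<open>j\<close> have
  expectations at most \<open>1\<close> and \<open>A\<close>. Since \<open>w\<^sub>j \<le> 1\<close> and \<open>\<kappa> \<le> 1\<close>, the power \<open>w\<^sub>j\<^sup>\<kappa>\<close> may be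
  replaced by \<open>w\<^sub>j\<close>; replacing both logarithms by tangents, at \<open>1\<close> and at \<open>A\<close>, and taking expectations
  gives \<open>E (\<Sum>\<^sub>j w\<^sub>j c\<^sub>j) + \<gamma> E ln S \<le> (\<gamma> - \<rho>) ln A\<close>. Working with tangents keeps every step linear in
  \<open>u\<^sub>j\<close>, \<open>v\<^sub>j\<close> and \<open>w\<^sub>j\<close>, so countable sums and infinite entropies cause no trouble.
\<close>

section \<open>Concave functionals of mixtures\<close>

text \<open>The mean value theorem writes the gap to the tangent as \<open>(\<phi>' z - \<phi>' g) (y - g)\<close> with \<open>z\<close> between
  \<open>g\<close> and \<open>y\<close>. The second bound takes the minimum of a linear and a quadratic remainder: the linear
  one is integrable as soon as \<open>y\<close> and \<open>g\<close> are, the quadratic one makes it of lower order for small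
  increments.\<close>

lemma concave_tangent_bounds:
  fixes \<phi> \<phi>' :: "real \<Rightarrow> real"
  assumes deriv: "\<And>y. 0 \<le> y \<Longrightarrow> (\<phi> has_real_derivative \<phi>' y) (at y)"
    and nonneg: "\<And>y. 0 \<le> y \<Longrightarrow> 0 \<le> \<phi>' y"
    and antimono: "\<And>x y. 0 \<le> x \<Longrightarrow> x \<le> y \<Longrightarrow> \<phi>' y \<le> \<phi>' x"
    and lipschitz: "\<And>x y. 0 \<le> x \<Longrightarrow> x \<le> y \<Longrightarrow> \<phi>' x - \<phi>' y \<le> K * (y - x)"
    and K: "0 \<le> K" and g: "0 \<le> g" and y: "0 \<le> y"
  shows "\<phi> y \<le> \<phi> g + \<phi>' g * (y - g)"
    and "\<phi> g + \<phi>' g * (y - g) - \<bar>y - g\<bar> * min (\<phi>' 0) (K * \<bar>y - g\<bar>) \<le> \<phi> y"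
proof -
  have "\<exists>z\<ge>0. min g y \<le> z \<and> z \<le> max g y \<and> \<phi> y - \<phi> g = \<phi>' z * (y - g)"
  proof (cases g y rule: linorder_cases)
    case less
    then obtain z where "g < z" "z < y" "\<phi> y - \<phi> g = (y - g) * \<phi>' z"
      using MVT2[of g y \<phi> \<phi>'] deriv g by auto
    then show ?thesis using g by (intro exI[of _ z]) auto
  next
    case equal
    then show ?thesis using g by (intro exI[of _ g]) auto
  next
    case greater
    then obtain z where "y < z" "z < g" "\<phi> g - \<phi> y = (g - y) * \<phi>' z"
      using MVT2[of y g \<phi> \<phi>'] deriv y by auto
    then show ?thesis using y by (intro exI[of _ z]) (auto simp: algebra_simps)
  qed
  then obtain z where z: "0 \<le> z" "min g y \<le> z" "z \<le> max g y"
    and eq: "\<phi> y - \<phi> g = \<phi>' z * (y - g)" by blast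
  have *: "\<phi> y - \<phi> g - \<phi>' g * (y - g) = (\<phi>' z - \<phi>' g) * (y - g)"
    by (simp add: eq algebra_simps)
  have "\<bar>\<phi>' z - \<phi>' g\<bar> \<le> \<phi>' 0"
    using nonneg[OF z(1)] nonneg[OF g] antimono[OF _ z(1)] antimono[OF _ g] by auto
  moreover have "\<bar>\<phi>' z - \<phi>' g\<bar> \<le> K * \<bar>z - g\<bar>"
    using lipschitz[of g z] lipschitz[of z g] antimono[of g z] antimono[of z g] g z(1)
    by (cases "g \<le> z") auto
  moreover have "K * \<bar>z - g\<bar> \<le> K * \<bar>y - g\<bar>"
    using K z by (intro mult_left_mono) auto
  ultimately have "\<bar>\<phi>' z - \<phi>' g\<bar> \<le> min (\<phi>' 0) (K * \<bar>y - g\<bar>)" by auto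
  then have "\<bar>(\<phi>' z - \<phi>' g) * (y - g)\<bar> \<le> \<bar>y - g\<bar> * min (\<phi>' 0) (K * \<bar>y - g\<bar>)"
    using mult_left_mono[of _ _ "\<bar>y - g\<bar>"] by (simp only: abs_mult mult.commute[of "\<bar>\<phi>' z - \<phi>' g\<bar>"] abs_ge_zero)
  then show "\<phi> g + \<phi>' g * (y - g) - \<bar>y - g\<bar> * min (\<phi>' 0) (K * \<bar>y - g\<bar>) \<le> \<phi> y"
    using * by linarith
  have "(\<phi>' z - \<phi>' g) * (y - g) \<le> 0"
    using antimono[of g z] antimono[of z g] g z
    by (cases "g \<le> y") (auto simp: mult_le_0_iff)
  then show "\<phi> y \<le> \<phi> g + \<phi>' g * (y - g)" using * by linarith
qed

lemma integrable_density_family: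
  fixes h :: "'t \<Rightarrow> 'a \<Rightarrow> real"
  assumes Q: "prob_space Q" and \<nu>: "prob_space \<nu>"
    and h_meas: "(\<lambda>(\<theta>, x). h \<theta> x) \<in> borel_measurable (\<nu> \<Otimes>\<^sub>M Q)"
    and h_nonneg: "\<And>\<theta> x. \<theta> \<in> space \<nu> \<Longrightarrow> x \<in> space Q \<Longrightarrow> 0 \<le> h \<theta> x"
    and h_mass: "\<And>\<theta>. \<theta> \<in> space \<nu> \<Longrightarrow> (\<integral>\<^sup>+x. ennreal (h \<theta> x) \<partial>Q) \<le> 1"
  shows "integrable (\<nu> \<Otimes>\<^sub>M Q) (\<lambda>(\<theta>, x). h \<theta> x)"
proof (rule integrableI_bounded)
  interpret Q: prob_space Q by fact
  interpret N: prob_space \<nu> by fact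
  have [measurable]: "(\<lambda>z. h (fst z) (snd z)) \<in> borel_measurable (\<nu> \<Otimes>\<^sub>M Q)"
    using h_meas by (simp add: case_prod_unfold)
  have "(\<integral>\<^sup>+z. ennreal (norm (case z of (\<theta>, x) \<Rightarrow> h \<theta> x)) \<partial>(\<nu> \<Otimes>\<^sub>M Q))
      = (\<integral>\<^sup>+\<theta>. \<integral>\<^sup>+x. ennreal (norm (h \<theta> x)) \<partial>Q \<partial>\<nu>)"
    by (subst Q.nn_integral_fst[symmetric]) (auto simp: case_prod_unfold)
  also have "\<dots> = (\<integral>\<^sup>+\<theta>. \<integral>\<^sup>+x. ennreal (h \<theta> x) \<partial>Q \<partial>\<nu>)"
    using h_nonneg by (intro nn_integral_cong) auto
  also have "\<dots> \<le> (\<integral>\<^sup>+\<theta>. 1 \<partial>\<nu>)"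
    using h_mass by (intro nn_integral_mono) auto
  also have "\<dots> < \<infinity>" by (simp add: N.emeasure_space_1)
  finally show "(\<integral>\<^sup>+z. ennreal (norm (case z of (\<theta>, x) \<Rightarrow> h \<theta> x)) \<partial>(\<nu> \<Otimes>\<^sub>M Q)) < \<infinity>" .
qed (rule h_meas)

text \<open>A bound on a smooth concave functional \<open>f \<mapsto> E\<^sub>Q \<phi>(f)\<close> over \<open>C\<close> passes to the mixture \<open>H\<close> of the
  \<open>h \<theta>\<close>, although \<open>C\<close> is only closed under moving towards a single \<open>h \<theta>\<close>. Let \<open>V\<close> be the supremum over
  \<open>C\<close> and take \<open>f \<in> C\<close>. Moving from \<open>f\<close> by a step \<open>t\<close> towards \<open>h \<theta>\<close> stays in \<open>C\<close>. The first-order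
  terms average out over \<open>\<theta>\<close>, so the mean value reached is at least the one after moving towards \<open>H\<close>
  instead, minus a remainder \<open>t \<eta>(t)\<close> that does not depend on \<open>f\<close> and has \<open>\<eta>(t) \<longlonglongrightarrow> 0\<close>. Hence
  \<open>V \<ge> (1 - t) E\<^sub>Q \<phi>(f) + t (E\<^sub>Q \<phi>(H) - \<eta>(t))\<close> by concavity. The supremum over \<open>f\<close> turns this into
  \<open>V \<ge> E\<^sub>Q \<phi>(H) - \<eta>(t)\<close>.\<close>

lemma concave_functional_of_mixture_le:
  fixes Q :: "'a measure" and \<nu> :: "'t measure" and h :: "'t \<Rightarrow> 'a \<Rightarrow> real"
    and C :: "('a \<Rightarrow> real) set" and \<phi> \<phi>' :: "real \<Rightarrow> real"
  assumes Q: "prob_space Q" and \<nu>: "prob_space \<nu>"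
    and h_meas: "(\<lambda>(\<theta>, x). h \<theta> x) \<in> borel_measurable (\<nu> \<Otimes>\<^sub>M Q)"
    and h_nonneg: "\<And>\<theta> x. \<theta> \<in> space \<nu> \<Longrightarrow> x \<in> space Q \<Longrightarrow> 0 \<le> h \<theta> x"
    and h_mass: "\<And>\<theta>. \<theta> \<in> space \<nu> \<Longrightarrow> (\<integral>\<^sup>+x. ennreal (h \<theta> x) \<partial>Q) \<le> 1"
    and G: "AE \<theta> in \<nu>. \<theta> \<in> G"
    and C_ne: "C \<noteq> {}"
    and C_int: "\<And>f. f \<in> C \<Longrightarrow> integrable Q f"
    and C_nonneg: "\<And>f x. f \<in> C \<Longrightarrow> x \<in> space Q \<Longrightarrow> 0 \<le> f x"
    and C_step: "\<And>f \<theta> t. f \<in> C \<Longrightarrow> \<theta> \<in> G \<Longrightarrow> 0 < t \<Longrightarrow> t < 1 \<Longrightarrow>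
        \<exists>g\<in>C. \<forall>x\<in>space Q. g x = (1 - t) * f x + t * h \<theta> x"
    and \<phi>_meas[measurable]: "\<phi> \<in> borel_measurable borel" "\<phi>' \<in> borel_measurable borel"
    and \<phi>_nonneg: "\<And>y. 0 \<le> y \<Longrightarrow> 0 \<le> \<phi> y"
    and deriv: "\<And>y. 0 \<le> y \<Longrightarrow> (\<phi> has_real_derivative \<phi>' y) (at y)"
    and deriv_nonneg: "\<And>y. 0 \<le> y \<Longrightarrow> 0 \<le> \<phi>' y"
    and antimono: "\<And>x y. 0 \<le> x \<Longrightarrow> x \<le> y \<Longrightarrow> \<phi>' y \<le> \<phi>' x"
    and lipschitz: "\<And>x y. 0 \<le> x \<Longrightarrow> x \<le> y \<Longrightarrow> \<phi>' x - \<phi>' y \<le> K * (y - x)"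
    and K: "0 \<le> K"
    and B: "\<And>f. f \<in> C \<Longrightarrow> (\<integral>x. \<phi> (f x) \<partial>Q) \<le> B"
  shows "(\<integral>x. \<phi> (\<integral>\<theta>. h \<theta> x \<partial>\<nu>) \<partial>Q) \<le> B"
proof -
  interpret Q: prob_space Q by fact
  interpret N: prob_space \<nu> by fact
  interpret P: pair_prob_space \<nu> Q ..
  note [measurable] = h_meas
  have h1[measurable]: "(\<lambda>z. h (fst z) (snd z)) \<in> borel_measurable (\<nu> \<Otimes>\<^sub>M Q)"
    using h_meas by (simp add: case_prod_unfold)
  have h_th[measurable]: "h \<theta> \<in> borel_measurable Q" if "\<theta> \<in> space \<nu>" for \<theta>
    using measurable_compose[OF measurable_Pair1'[OF that] h1] by simp
  define L where "L = \<phi>' 0"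
  have L: "\<phi>' y \<le> L" if "0 \<le> y" for y using antimono that by (simp add: L_def)
  have above: "\<phi> y \<le> \<phi> g + \<phi>' g * (y - g)" if "0 \<le> g" "0 \<le> y" for g y
    using that by (intro concave_tangent_bounds(1)[where K=K] deriv deriv_nonneg antimono lipschitz K)
  have below: "\<phi> g + \<phi>' g * (y - g) - \<bar>y - g\<bar> * min L (K * \<bar>y - g\<bar>) \<le> \<phi> y"
    if "0 \<le> g" "0 \<le> y" for g y
    unfolding L_def using that
    by (intro concave_tangent_bounds(2) deriv deriv_nonneg antimono lipschitz K)
  have L0: "0 \<le> L" using deriv_nonneg[of 0] by (simp add: L_def)
  define H where "H x = (\<integral>\<theta>. h \<theta> x \<partial>\<nu>)" for x
  have [measurable]: "H \<in> borel_measurable Q"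
    unfolding H_def by (rule N.borel_measurable_lebesgue_integral) (use h1 in measurable)
  have H0: "0 \<le> H x" if "x \<in> space Q" for x
    unfolding H_def using h_nonneg that by (intro integral_nonneg_AE AE_I2) auto
  have hint: "integrable (\<nu> \<Otimes>\<^sub>M Q) (\<lambda>z. h (fst z) (snd z))"
    using integrable_density_family[OF Q \<nu> h_meas h_nonneg h_mass] by (simp add: case_prod_unfold)
  have Hint: "integrable Q H"
    using P.integrable_snd[of h] hint by (simp add: case_prod_unfold H_def[abs_def])
  have h_AE: "AE x in Q. integrable \<nu> (\<lambda>\<theta>. h \<theta> x)"
    using P.AE_integrable_snd[of h] hint by (simp add: case_prod_unfold)
  have lift: "integrable (\<nu> \<Otimes>\<^sub>M Q) (\<lambda>z. f (snd z)) \<and> (\<integral>z. f (snd z) \<partial>(\<nu> \<Otimes>\<^sub>M Q)) = (\<integral>x. f x \<partial>Q)"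
    if f: "integrable Q f" for f :: "'a \<Rightarrow> real"
  proof -
    have [measurable]: "f \<in> borel_measurable Q" using f by simp
    have i: "integrable (\<nu> \<Otimes>\<^sub>M Q) (\<lambda>z. f (snd z))"
    proof (rule integrableI_bounded)
      have "(\<integral>\<^sup>+z. ennreal (norm (f (snd z))) \<partial>(\<nu> \<Otimes>\<^sub>M Q)) = (\<integral>\<^sup>+\<theta>. \<integral>\<^sup>+x. ennreal (norm (f x)) \<partial>Q \<partial>\<nu>)"
        by (subst Q.nn_integral_fst[symmetric]) auto
      also have "\<dots> < \<infinity>" using f by (simp add: N.emeasure_space_1 integrable_iff_bounded)
      finally show "(\<integral>\<^sup>+z. ennreal (norm (f (snd z))) \<partial>(\<nu> \<Otimes>\<^sub>M Q)) < \<infinity>" .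
    qed simp
    have "(\<integral>z. f (snd z) \<partial>(\<nu> \<Otimes>\<^sub>M Q)) = (\<integral>\<theta>. \<integral>x. f x \<partial>Q \<partial>\<nu>)"
      using P.integral_fst'[OF i] by simp
    also have "\<dots> = (\<integral>x. f x \<partial>Q)" by (simp add: N.prob_space)
    finally show ?thesis using i by blast
  qed
  have \<phi>_le: "\<phi> y \<le> \<phi> 0 + L * y" if "0 \<le> y" for y
    using above[of 0 y] L[of 0] that mult_right_mono[of "\<phi>' 0" L y] by simp
  have \<phi>_int: "integrable M (\<lambda>z. \<phi> (f z))"
    if "finite_measure M" "integrable M f" "\<And>z. z \<in> space M \<Longrightarrow> 0 \<le> f z"
    for M :: "'b measure" and f :: "'b \<Rightarrow> real"
  proof (rule Bochner_Integration.integrable_bound)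
    interpret finite_measure M by fact
    show "integrable M (\<lambda>z. \<phi> 0 + L * f z)" using that by auto
    show "(\<lambda>z. \<phi> (f z)) \<in> borel_measurable M"
      using that(2) by (auto intro!: measurable_compose[OF _ \<phi>_meas(1)])
    show "AE z in M. norm (\<phi> (f z)) \<le> norm (\<phi> 0 + L * f z)"
      using that(3) \<phi>_le \<phi>_nonneg by (intro AE_I2) (smt (verit) real_norm_def)
  qed
  define v where "v z = h (fst z) (snd z) - H (snd z)" for z
  \<comment> \<open>The remainder of \<open>below\<close> for an increment \<open>t * v z\<close>, divided by \<open>t\<close>. It involves \<open>v\<close> only, not \<open>f\<close>.\<close>
  define r where "r t z = \<bar>v z\<bar> * min L (K * (t * \<bar>v z\<bar>))" for t z
  have [measurable]: "v \<in> borel_measurable (\<nu> \<Otimes>\<^sub>M Q)" unfolding v_def by measurable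
  have vint: "integrable (\<nu> \<Otimes>\<^sub>M Q) v"
    unfolding v_def using hint lift[OF Hint] by auto
  have [measurable]: "r t \<in> borel_measurable (\<nu> \<Otimes>\<^sub>M Q)" for t unfolding r_def by measurable
  have r_bound: "norm (r t z) \<le> L * \<bar>v z\<bar>" if "0 \<le> t" for t z
    using that L0 K by (auto simp: r_def abs_mult min_def intro!: mult_nonneg_nonneg
        order_trans[OF mult_left_mono[of "K * (t * \<bar>v z\<bar>)" L "\<bar>v z\<bar>"]])
  have rint: "integrable (\<nu> \<Otimes>\<^sub>M Q) (r t)" if "0 \<le> t" for t
    by (rule Bochner_Integration.integrable_bound[where f="\<lambda>z. L * \<bar>v z\<bar>"])
      (use vint r_bound that L0 in \<open>auto intro!: AE_I2 simp: abs_mult\<close>)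
  define \<eta> where "\<eta> t = (\<integral>z. r t z \<partial>(\<nu> \<Otimes>\<^sub>M Q))" for t
  define V where "V = Sup ((\<lambda>f. \<integral>x. \<phi> (f x) \<partial>Q) ` C)"
  have V_up: "(\<integral>x. \<phi> (f x) \<partial>Q) \<le> V" if "f \<in> C" for f
    unfolding V_def using B that by (intro cSup_upper) (auto intro!: bdd_aboveI2)
  have VB: "V \<le> B" unfolding V_def using B C_ne by (intro cSup_least) auto
  have key: "(1 - t) * (\<integral>x. \<phi> (f x) \<partial>Q) + t * ((\<integral>x. \<phi> (H x) \<partial>Q) - \<eta> t) \<le> V"
    if f: "f \<in> C" and t: "0 < t" "t < 1" for f t
  proof -
    have f0: "0 \<le> f x" if "x \<in> space Q" for x using C_nonneg f that by blast
    have fi: "integrable Q f" using C_int f by blast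
    have [measurable]: "f \<in> borel_measurable Q" using fi by simp
    define g where "g x = (1 - t) * f x + t * H x" for x
    have [measurable]: "g \<in> borel_measurable Q" unfolding g_def by measurable
    have gi: "integrable Q g" unfolding g_def using fi Hint by auto
    have g0: "0 \<le> g x" if "x \<in> space Q" for x unfolding g_def using f0 H0 that t by simp
    define s where "s z = (1 - t) * f (snd z) + t * h (fst z) (snd z)" for z
    have [measurable]: "s \<in> borel_measurable (\<nu> \<Otimes>\<^sub>M Q)" unfolding s_def by measurable
    have si: "integrable (\<nu> \<Otimes>\<^sub>M Q) s" unfolding s_def using lift[OF fi] hint by auto
    have s0: "0 \<le> s z" if "z \<in> space (\<nu> \<Otimes>\<^sub>M Q)" for z
      unfolding s_def using f0 h_nonneg that t by (auto simp: space_pair_measure)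
    have sg: "s z - g (snd z) = t * v z" for z by (simp add: s_def g_def v_def algebra_simps)
    have \<phi>s: "integrable (\<nu> \<Otimes>\<^sub>M Q) (\<lambda>z. \<phi> (s z))"
      by (rule \<phi>_int[OF _ si s0]) (rule P.finite_measure_axioms)
    have \<phi>g: "integrable Q (\<lambda>x. \<phi> (g x))"
      by (rule \<phi>_int[OF _ gi g0]) (rule Q.finite_measure_axioms)
    have \<phi>f: "integrable Q (\<lambda>x. \<phi> (f x))"
      by (rule \<phi>_int[OF _ fi f0]) (rule Q.finite_measure_axioms)
    have \<phi>H: "integrable Q (\<lambda>x. \<phi> (H x))"
      by (rule \<phi>_int[OF _ Hint H0]) (rule Q.finite_measure_axioms)
    have lin: "integrable (\<nu> \<Otimes>\<^sub>M Q) (\<lambda>z. \<phi>' (g (snd z)) * v z)"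
    proof (rule Bochner_Integration.integrable_bound[where f="\<lambda>z. L * v z"])
      show "AE z in \<nu> \<Otimes>\<^sub>M Q. norm (\<phi>' (g (snd z)) * v z) \<le> norm (L * v z)"
        using L deriv_nonneg g0 L0 by (intro AE_I2) (auto simp: abs_mult space_pair_measure intro!: mult_right_mono)
    qed (use vint in auto)
    \<comment> \<open>The first-order term vanishes because \<open>v\<close> has mean zero under \<open>\<nu>\<close> at almost every point.\<close>
    have lin0: "(\<integral>z. \<phi>' (g (snd z)) * v z \<partial>(\<nu> \<Otimes>\<^sub>M Q)) = 0"
    proof -
      have "(\<integral>z. \<phi>' (g (snd z)) * v z \<partial>(\<nu> \<Otimes>\<^sub>M Q)) = (\<integral>x. \<integral>\<theta>. \<phi>' (g x) * v (\<theta>, x) \<partial>\<nu> \<partial>Q)"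
        using P.integral_snd[of "\<lambda>\<theta> x. \<phi>' (g x) * v (\<theta>, x)"] lin by (simp add: case_prod_unfold)
      also have "\<dots> = (\<integral>x. 0 \<partial>Q)"
      proof (rule integral_cong_AE)
        show "AE x in Q. (\<integral>\<theta>. \<phi>' (g x) * v (\<theta>, x) \<partial>\<nu>) = 0"
          using h_AE by eventually_elim (simp add: v_def H_def N.prob_space)
      qed auto
      finally show ?thesis by simp
    qed
    have "(\<integral>z. \<phi> (g (snd z)) + t * (\<phi>' (g (snd z)) * v z) - t * r t z \<partial>(\<nu> \<Otimes>\<^sub>M Q))
        \<le> (\<integral>z. \<phi> (s z) \<partial>(\<nu> \<Otimes>\<^sub>M Q))"
    proof (rule integral_mono_AE)
      show "AE z in \<nu> \<Otimes>\<^sub>M Q. \<phi> (g (snd z)) + t * (\<phi>' (g (snd z)) * v z) - t * r t z \<le> \<phi> (s z)"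
      proof (rule AE_I2)
        fix z assume z: "z \<in> space (\<nu> \<Otimes>\<^sub>M Q)"
        have "0 \<le> g (snd z)" using z g0 by (auto simp: space_pair_measure)
        from below[OF this s0[OF z], unfolded sg]
        show "\<phi> (g (snd z)) + t * (\<phi>' (g (snd z)) * v z) - t * r t z \<le> \<phi> (s z)"
          using t by (simp add: r_def abs_mult mult_ac)
      qed
    qed (use lift[OF \<phi>g] lin rint[of t] t \<phi>s in auto)
    moreover have "(\<integral>z. \<phi> (g (snd z)) + t * (\<phi>' (g (snd z)) * v z) - t * r t z \<partial>(\<nu> \<Otimes>\<^sub>M Q))
        = (\<integral>x. \<phi> (g x) \<partial>Q) - t * \<eta> t"
      using lift[OF \<phi>g] lin rint[of t] t lin0 by (simp add: \<eta>_def)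
    moreover have "(\<integral>z. \<phi> (s z) \<partial>(\<nu> \<Otimes>\<^sub>M Q)) \<le> V"
    proof -
      have "(\<integral>z. \<phi> (s z) \<partial>(\<nu> \<Otimes>\<^sub>M Q)) = (\<integral>\<theta>. \<integral>x. \<phi> (s (\<theta>, x)) \<partial>Q \<partial>\<nu>)"
        using P.integral_fst'[OF \<phi>s] by simp
      also have "\<dots> \<le> (\<integral>\<theta>. V \<partial>\<nu>)"
      proof (rule integral_mono_AE)
        show "integrable \<nu> (\<lambda>\<theta>. \<integral>x. \<phi> (s (\<theta>, x)) \<partial>Q)" using P.integrable_fst'[OF \<phi>s] .
        show "AE \<theta> in \<nu>. (\<integral>x. \<phi> (s (\<theta>, x)) \<partial>Q) \<le> V"
          using G
        proof eventually_elim
          case (elim \<theta>)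
          obtain g' where g': "g' \<in> C" "\<forall>x\<in>space Q. g' x = (1 - t) * f x + t * h \<theta> x"
            using C_step[OF f elim t] by blast
          have "(\<integral>x. \<phi> (s (\<theta>, x)) \<partial>Q) = (\<integral>x. \<phi> (g' x) \<partial>Q)"
            using g'(2) by (intro Bochner_Integration.integral_cong) (auto simp: s_def)
          then show ?case using V_up[OF g'(1)] by simp
        qed
      qed auto
      finally show ?thesis by (simp add: N.prob_space)
    qed
    moreover have "(1 - t) * (\<integral>x. \<phi> (f x) \<partial>Q) + t * (\<integral>x. \<phi> (H x) \<partial>Q) \<le> (\<integral>x. \<phi> (g x) \<partial>Q)"
    proof -
      have "(1 - t) * (\<integral>x. \<phi> (f x) \<partial>Q) + t * (\<integral>x. \<phi> (H x) \<partial>Q)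
          = (\<integral>x. (1 - t) * \<phi> (f x) + t * \<phi> (H x) \<partial>Q)"
        using \<phi>f \<phi>H by simp
      also have "\<dots> \<le> (\<integral>x. \<phi> (g x) \<partial>Q)"
      proof (rule integral_mono)
        fix x assume x: "x \<in> space Q"
        have "(1 - t) * \<phi> (f x) + t * \<phi> (H x) \<le>
            (1 - t) * (\<phi> (g x) + \<phi>' (g x) * (f x - g x)) + t * (\<phi> (g x) + \<phi>' (g x) * (H x - g x))"
          using above[OF g0[OF x] f0[OF x]] above[OF g0[OF x] H0[OF x]] t
          by (intro add_mono mult_left_mono) auto
        also have "\<dots> = \<phi> (g x) + \<phi>' (g x) * ((1 - t) * f x + t * H x - g x)"
          by (simp add: algebra_simps)
        also have "\<dots> = \<phi> (g x)" by (simp add: g_def)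
        finally show "(1 - t) * \<phi> (f x) + t * \<phi> (H x) \<le> \<phi> (g x)" .
      qed (use \<phi>f \<phi>H \<phi>g in auto)
      finally show ?thesis .
    qed
    ultimately show ?thesis by (simp add: algebra_simps)
  qed
  have HV: "(\<integral>x. \<phi> (H x) \<partial>Q) - \<eta> t \<le> V" if t: "0 < t" "t < 1" for t
  proof -
    have "(\<integral>x. \<phi> (f x) \<partial>Q) \<le> (V - t * ((\<integral>x. \<phi> (H x) \<partial>Q) - \<eta> t)) / (1 - t)" if "f \<in> C" for f
      using key[OF that t] t by (simp add: field_simps)
    then have "V \<le> (V - t * ((\<integral>x. \<phi> (H x) \<partial>Q) - \<eta> t)) / (1 - t)"
      unfolding V_def using C_ne by (intro cSup_least) auto
    then have "t * ((\<integral>x. \<phi> (H x) \<partial>Q) - \<eta> t) \<le> t * V" using t by (simp add: field_simps)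
    then show ?thesis using t by simp
  qed
  have "(\<lambda>k. \<eta> (1 / real (k + 2))) \<longlonglongrightarrow> (\<integral>z. 0 \<partial>(\<nu> \<Otimes>\<^sub>M Q))"
    unfolding \<eta>_def
  proof (rule integral_dominated_convergence[where w="\<lambda>z. L * \<bar>v z\<bar>"])
    show "AE z in \<nu> \<Otimes>\<^sub>M Q. (\<lambda>k. r (1 / real (k + 2)) z) \<longlonglongrightarrow> 0"
    proof (rule AE_I2)
      fix z
      have "(\<lambda>k. 1 / real (k + 2)) \<longlonglongrightarrow> 0"
        using LIMSEQ_ignore_initial_segment[OF lim_1_over_n[where 'a=real], of 2] by simp
      then have "(\<lambda>k. r (1 / real (k + 2)) z) \<longlonglongrightarrow> \<bar>v z\<bar> * min L (K * (0 * \<bar>v z\<bar>))"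
        unfolding r_def by (intro tendsto_intros)
      then show "(\<lambda>k. r (1 / real (k + 2)) z) \<longlonglongrightarrow> 0" using L0 by simp
    qed
    show "AE z in \<nu> \<Otimes>\<^sub>M Q. norm (r (1 / real (k + 2)) z) \<le> L * \<bar>v z\<bar>" for k
      by (intro AE_I2 r_bound) simp
  qed (use vint in auto)
  then have "(\<lambda>k. (\<integral>x. \<phi> (H x) \<partial>Q) - \<eta> (1 / real (k + 2))) \<longlonglongrightarrow> (\<integral>x. \<phi> (H x) \<partial>Q) - 0"
    by (intro tendsto_intros) simp
  then have "(\<integral>x. \<phi> (H x) \<partial>Q) - 0 \<le> V"
    by (rule LIMSEQ_le_const2) (use HV in auto)
  then show ?thesis using VB by (simp add: H_def)
qed

lemma powr_add_le:
  fixes a b \<rho> :: real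
  assumes "0 \<le> a" "0 \<le> b" "0 < \<rho>" "\<rho> < 1"
  shows "(a + b) powr \<rho> \<le> a powr \<rho> + b powr \<rho>"
proof (cases "a = 0 \<or> b = 0")
  case False
  then have ab: "0 < a" "0 < b" using assms by auto
  have split: "x powr \<rho> = x * x powr (\<rho> - 1)" if "0 < x" for x :: real
    using that by (simp add: powr_diff)
  have "(a + b) powr (\<rho> - 1) \<le> a powr (\<rho> - 1)" "(a + b) powr (\<rho> - 1) \<le> b powr (\<rho> - 1)"
    using ab assms by (auto intro!: powr_mono2')
  then have "a * (a + b) powr (\<rho> - 1) + b * (a + b) powr (\<rho> - 1)
      \<le> a * a powr (\<rho> - 1) + b * b powr (\<rho> - 1)"
    using ab by (intro add_mono mult_left_mono) auto
  then show ?thesis using ab split[of "a + b"] split[of a] split[of b] by (simp add: algebra_simps)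
qed auto

lemma powr_le_one_plus:
  fixes y \<rho> :: real
  assumes "0 \<le> y" "0 < \<rho>" "\<rho> < 1"
  shows "y powr \<rho> \<le> 1 + y"
proof -
  have "y powr \<rho> \<le> (1 + y) powr \<rho>" using assms by (intro powr_mono2) auto
  also have "\<dots> \<le> (1 + y) powr 1" using assms by (intro powr_mono) auto
  finally show ?thesis using assms by simp
qed

lemma integrable_powr:
  fixes f :: "'a \<Rightarrow> real"
  assumes "finite_measure M" "integrable M f" "AE x in M. 0 \<le> f x" "0 < \<rho>" "\<rho> < 1"
  shows "integrable M (\<lambda>x. f x powr \<rho>)"
proof -
  interpret finite_measure M by fact
  show ?thesis
  proof (rule Bochner_Integration.integrable_bound[where f="\<lambda>x. 1 + f x"])
    show "AE x in M. norm (f x powr \<rho>) \<le> norm (1 + f x)"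
      using assms(3) by eventually_elim (use powr_le_one_plus assms(4,5) in auto)
  qed (use assms(2) in auto)
qed

text \<open>The power \<open>y powr \<rho>\<close> has infinite slope at 0, so the smooth case is applied to
  \<open>(y + \<delta>) powr \<rho>\<close>, which exceeds \<open>y powr \<rho>\<close> by at most \<open>\<delta> powr \<rho>\<close>.\<close>

lemma affinity_of_mixture_le:
  fixes Q :: "'a measure" and \<nu> :: "'t measure" and h :: "'t \<Rightarrow> 'a \<Rightarrow> real"
    and C :: "('a \<Rightarrow> real) set" and \<rho> \<alpha> :: real
  assumes Q: "prob_space Q" and \<nu>: "prob_space \<nu>"
    and h_meas: "(\<lambda>(\<theta>, x). h \<theta> x) \<in> borel_measurable (\<nu> \<Otimes>\<^sub>M Q)"
    and h_nonneg: "\<And>\<theta> x. \<theta> \<in> space \<nu> \<Longrightarrow> x \<in> space Q \<Longrightarrow> 0 \<le> h \<theta> x"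
    and h_mass: "\<And>\<theta>. \<theta> \<in> space \<nu> \<Longrightarrow> (\<integral>\<^sup>+x. ennreal (h \<theta> x) \<partial>Q) \<le> 1"
    and G: "AE \<theta> in \<nu>. \<theta> \<in> G"
    and C_ne: "C \<noteq> {}"
    and C_int: "\<And>f. f \<in> C \<Longrightarrow> integrable Q f"
    and C_nonneg: "\<And>f x. f \<in> C \<Longrightarrow> x \<in> space Q \<Longrightarrow> 0 \<le> f x"
    and C_step: "\<And>f \<theta> t. f \<in> C \<Longrightarrow> \<theta> \<in> G \<Longrightarrow> 0 < t \<Longrightarrow> t < 1 \<Longrightarrow>
        \<exists>g\<in>C. \<forall>x\<in>space Q. g x = (1 - t) * f x + t * h \<theta> x"
    and \<rho>: "0 < \<rho>" "\<rho> < 1"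
    and \<alpha>: "\<And>f. f \<in> C \<Longrightarrow> (\<integral>x. f x powr \<rho> \<partial>Q) \<le> \<alpha>"
  shows "(\<integral>x. (\<integral>\<theta>. h \<theta> x \<partial>\<nu>) powr \<rho> \<partial>Q) \<le> \<alpha>"
proof (rule field_le_epsilon)
  fix e :: real assume e: "0 < e"
  interpret Q: prob_space Q by fact
  interpret N: prob_space \<nu> by fact
  define \<delta> where "\<delta> = e powr (1 / \<rho>)"
  have \<delta>: "0 < \<delta>" "\<delta> powr \<rho> = e" using e \<rho> by (auto simp: \<delta>_def powr_powr)
  define \<phi>' where "\<phi>' y = \<rho> * (y + \<delta>) powr (\<rho> - 1)" for y
  define K where "K = \<rho> * (1 - \<rho>) * \<delta> powr (\<rho> - 2)"
  have shifted: "(\<integral>x. ((\<integral>\<theta>. h \<theta> x \<partial>\<nu>) + \<delta>) powr \<rho> \<partial>Q) \<le> \<alpha> + e"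
  proof (rule concave_functional_of_mixture_le[where h=h and C=C and \<phi>="\<lambda>y. (y + \<delta>) powr \<rho>"
        and \<phi>'=\<phi>' and K=K and G=G and Q=Q and \<nu>=\<nu>])
    show "\<phi>' \<in> borel_measurable borel" unfolding \<phi>'_def by measurable
    show "0 \<le> K" using \<rho> by (simp add: K_def)
    show "0 \<le> \<phi>' y" if "0 \<le> y" for y using \<rho> by (simp add: \<phi>'_def)
    show "\<phi>' y \<le> \<phi>' x" if "0 \<le> x" "x \<le> y" for x y
      unfolding \<phi>'_def using that \<rho> \<delta> by (intro mult_left_mono powr_mono2') auto
    show "((\<lambda>y. (y + \<delta>) powr \<rho>) has_real_derivative \<phi>' y) (at y)" if "0 \<le> y" for y
      unfolding \<phi>'_def using that \<delta> by (auto intro!: derivative_eq_intros)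
    show "\<phi>' x - \<phi>' y \<le> K * (y - x)" if xy: "0 \<le> x" "x \<le> y" for x y
    proof (cases "x = y")
      case False
      then have "x < y" using xy by simp
      moreover have "(\<phi>' has_real_derivative \<rho> * ((\<rho> - 1) * (z + \<delta>) powr (\<rho> - 2))) (at z)"
        if "x \<le> z" for z
        unfolding \<phi>'_def using that xy \<delta> by (auto intro!: derivative_eq_intros)
      ultimately obtain z where z: "x < z" "z < y"
        "\<phi>' y - \<phi>' x = (y - x) * (\<rho> * ((\<rho> - 1) * (z + \<delta>) powr (\<rho> - 2)))"
        using MVT2[of x y \<phi>' "\<lambda>z. \<rho> * ((\<rho> - 1) * (z + \<delta>) powr (\<rho> - 2))"] by auto
      have "(z + \<delta>) powr (\<rho> - 2) \<le> \<delta> powr (\<rho> - 2)"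
        using z xy \<delta> \<rho> by (intro powr_mono2') auto
      then have "(y - x) * (\<rho> * (1 - \<rho>)) * (z + \<delta>) powr (\<rho> - 2)
          \<le> (y - x) * (\<rho> * (1 - \<rho>)) * \<delta> powr (\<rho> - 2)"
        using xy \<rho> by (intro mult_left_mono) auto
      then show ?thesis using z(3) by (simp add: K_def algebra_simps)
    qed simp
    show "(\<integral>x. (f x + \<delta>) powr \<rho> \<partial>Q) \<le> \<alpha> + e" if f: "f \<in> C" for f
    proof -
      have fi: "integrable Q (\<lambda>x. f x powr \<rho>)"
        using C_int[OF f] C_nonneg[OF f] \<rho> by (intro integrable_powr Q.finite_measure_axioms) auto
      have "(\<integral>x. (f x + \<delta>) powr \<rho> \<partial>Q) \<le> (\<integral>x. f x powr \<rho> + \<delta> powr \<rho> \<partial>Q)"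
      proof (rule integral_mono)
        show "integrable Q (\<lambda>x. (f x + \<delta>) powr \<rho>)"
          using C_int[OF f] C_nonneg[OF f] \<rho> \<delta>(1)
          by (intro integrable_powr Q.finite_measure_axioms) (auto intro!: AE_I2 add_nonneg_nonneg)
        show "(f x + \<delta>) powr \<rho> \<le> f x powr \<rho> + \<delta> powr \<rho>" if "x \<in> space Q" for x
          using C_nonneg[OF f that] \<rho> \<delta>(1) by (intro powr_add_le) auto
      qed (use fi in auto)
      also have "\<dots> = (\<integral>x. f x powr \<rho> \<partial>Q) + e"
        using fi \<delta>(2) by (simp add: Q.prob_space)
      finally show ?thesis using \<alpha>[OF f] by simp
    qed
  qed (fact Q \<nu> h_meas h_nonneg h_mass G C_ne C_int C_nonneg C_step | simp)+
  interpret P: pair_prob_space \<nu> Q ..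
  have H0: "0 \<le> (\<integral>\<theta>. h \<theta> x \<partial>\<nu>)" if "x \<in> space Q" for x
    using h_nonneg that by (intro integral_nonneg_AE AE_I2) auto
  have Hint: "integrable Q (\<lambda>x. \<integral>\<theta>. h \<theta> x \<partial>\<nu>)"
    by (rule P.integrable_snd[OF integrable_density_family[OF Q \<nu> h_meas h_nonneg h_mass]])
  have "(\<integral>x. (\<integral>\<theta>. h \<theta> x \<partial>\<nu>) powr \<rho> \<partial>Q) \<le> (\<integral>x. ((\<integral>\<theta>. h \<theta> x \<partial>\<nu>) + \<delta>) powr \<rho> \<partial>Q)"
    using Hint H0 \<rho> \<delta>(1)
    by (intro integral_mono integrable_powr Q.finite_measure_axioms powr_mono2)
      (auto intro!: AE_I2 add_nonneg_nonneg)
  then show "(\<integral>x. (\<integral>\<theta>. h \<theta> x \<partial>\<nu>) powr \<rho> \<partial>Q) \<le> \<alpha> + e" using shifted by simp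
qed

section \<open>Evidence of independent samples\<close>

text \<open>The true density enters the main argument only through the ratios of the model densities to it.
  Their mean under \<open>Q\<close> may be less than 1, because a model density may put mass where the true density
  vanishes.\<close>

locale likelihood_ratios =
  fixes Q :: "'a measure" and \<pi> :: "'t measure" and h :: "'t \<Rightarrow> 'a \<Rightarrow> real"
  assumes Q: "prob_space Q" and prior: "prob_space \<pi>"
    and h_meas: "(\<lambda>(\<theta>, x). h \<theta> x) \<in> borel_measurable (\<pi> \<Otimes>\<^sub>M Q)"
    and h_nonneg: "\<And>\<theta> x. \<theta> \<in> space \<pi> \<Longrightarrow> x \<in> space Q \<Longrightarrow> 0 \<le> h \<theta> x"
    and h_mass: "\<And>\<theta>. \<theta> \<in> space \<pi> \<Longrightarrow> (\<integral>\<^sup>+x. ennreal (h \<theta> x) \<partial>Q) \<le> 1"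

sublocale likelihood_ratios \<subseteq> Q: prob_space Q by (rule Q)
sublocale likelihood_ratios \<subseteq> prior: prob_space \<pi> by (rule prior)
sublocale likelihood_ratios \<subseteq> samples: product_prob_space "\<lambda>_::nat. Q" ..

context likelihood_ratios
begin

abbreviation samples :: "nat \<Rightarrow> (nat \<Rightarrow> 'a) measure" where
  "samples n \<equiv> PiM {..<n} (\<lambda>_. Q)"

definition evidence :: "nat \<Rightarrow> 't set \<Rightarrow> (nat \<Rightarrow> 'a) \<Rightarrow> ennreal" where
  "evidence n A X = (\<integral>\<^sup>+\<theta>\<in>A. likelihood n h \<theta> X \<partial>\<pi>)"

lemma h_measurable: "(\<lambda>z. h (fst z) (snd z)) \<in> borel_measurable (\<pi> \<Otimes>\<^sub>M Q)"
  using h_meas by (simp add: case_prod_unfold)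

lemma h_measurable_comp[measurable (raw)]:
  assumes "f \<in> measurable M \<pi>" "g \<in> measurable M Q"
  shows "(\<lambda>z. h (f z) (g z)) \<in> borel_measurable M"
  using measurable_compose[OF measurable_Pair[OF assms] h_measurable] by simp

lemma h_section[measurable]: "\<theta> \<in> space \<pi> \<Longrightarrow> h \<theta> \<in> borel_measurable Q"
  by measurable

lemma likelihood_measurable[measurable (raw)]:
  assumes f[measurable]: "f \<in> measurable M \<pi>" and g[measurable]: "g \<in> measurable M (samples n)"
  shows "(\<lambda>z. likelihood n h (f z) (g z)) \<in> borel_measurable M"
proof -
  have [measurable]: "(\<lambda>z. g z i) \<in> measurable M Q" if "i < n" for i
    using measurable_compose[OF g measurable_component_singleton[of i]] that by simp
  show ?thesis
    unfolding likelihood_def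
    by (intro borel_measurable_prod_ennreal measurable_compose[OF _ measurable_ennreal] h_measurable_comp)
      auto
qed

lemma evidence_measurable[measurable]:
  assumes [measurable]: "A \<in> sets \<pi>"
  shows "evidence n A \<in> borel_measurable (samples n)"
  unfolding evidence_def[abs_def] by measurable

lemma samples_prob_space: "prob_space (samples n)"
  by (rule prob_space_PiM) (rule Q)

lemma likelihood_mass:
  assumes "\<theta> \<in> space \<pi>"
  shows "(\<integral>\<^sup>+X. likelihood n h \<theta> X \<partial>samples n) \<le> 1"
proof -
  have "(\<integral>\<^sup>+X. likelihood n h \<theta> X \<partial>samples n) = (\<Prod>i<n. \<integral>\<^sup>+x. ennreal (h \<theta> x) \<partial>Q)"
    unfolding likelihood_def using h_section[OF assms]
    by (intro samples.product_nn_integral_prod) auto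
  also have "\<dots> \<le> 1" using h_mass[OF assms] by (intro prod_le_1) auto
  finally show ?thesis .
qed

lemma evidence_mass:
  assumes A[measurable]: "A \<in> sets \<pi>"
  shows "(\<integral>\<^sup>+X. evidence n A X \<partial>samples n) \<le> emeasure \<pi> A"
proof -
  interpret S: prob_space "samples n" by (rule samples_prob_space)
  interpret P: pair_prob_space \<pi> "samples n" ..
  have "(\<integral>\<^sup>+X. evidence n A X \<partial>samples n)
      = (\<integral>\<^sup>+\<theta>. \<integral>\<^sup>+X. likelihood n h \<theta> X * indicator A \<theta> \<partial>samples n \<partial>\<pi>)"
    unfolding evidence_def
    by (rule P.Fubini') measurable
  also have "\<dots> = (\<integral>\<^sup>+\<theta>. (\<integral>\<^sup>+X. likelihood n h \<theta> X \<partial>samples n) * indicator A \<theta> \<partial>\<pi>)"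
    by (intro nn_integral_cong nn_integral_multc) measurable
  also have "\<dots> \<le> (\<integral>\<^sup>+\<theta>. indicator A \<theta> \<partial>\<pi>)"
    using likelihood_mass by (intro nn_integral_mono) (auto simp: indicator_def)
  finally show ?thesis by simp
qed

lemma evidence_finite_AE:
  assumes [measurable]: "A \<in> sets \<pi>"
  shows "AE X in samples n. evidence n A X < \<top>"
proof -
  have "(\<integral>\<^sup>+X. evidence n A X \<partial>samples n) < \<infinity>"
    using evidence_mass[OF assms, of n] prior.emeasure_le_1[of A]
    by (metis ennreal_one_less_top infinity_ennreal_def le_less_trans order_trans)
  then have "AE X in samples n. evidence n A X \<noteq> \<infinity>"
    by (intro nn_integral_PInf_AE) auto
  then show ?thesis by eventually_elim (auto simp: less_top)
qed

text \<open>The form in which mixtures occur when one more observation is integrated out: the unnormalised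
  weights \<open>W\<close> are the likelihoods of the earlier observations. Both sides are homogeneous of degree \<open>\<rho>\<close>
  in \<open>W\<close>, which reduces the claim to a probability measure.\<close>

lemma weighted_affinity_le:
  fixes W :: "'t \<Rightarrow> ennreal"
  assumes A[measurable]: "A \<in> sets \<pi>" and W[measurable]: "W \<in> borel_measurable \<pi>"
    and fin: "(\<integral>\<^sup>+\<theta>\<in>A. W \<theta> \<partial>\<pi>) < \<top>"
    and C_ne: "C \<noteq> {}"
    and C_int: "\<And>f. f \<in> C \<Longrightarrow> integrable Q f"
    and C_nonneg: "\<And>f x. f \<in> C \<Longrightarrow> x \<in> space Q \<Longrightarrow> 0 \<le> f x"
    and C_step: "\<And>f \<theta> t. f \<in> C \<Longrightarrow> \<theta> \<in> A \<Longrightarrow> 0 < t \<Longrightarrow> t < 1 \<Longrightarrow>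
        \<exists>g\<in>C. \<forall>x\<in>space Q. g x = (1 - t) * f x + t * h \<theta> x"
    and \<rho>: "0 < \<rho>" "\<rho> < 1"
    and \<alpha>: "\<And>f. f \<in> C \<Longrightarrow> (\<integral>x. f x powr \<rho> \<partial>Q) \<le> \<alpha>"
  shows "(\<integral>\<^sup>+x. ennreal (enn2real (\<integral>\<^sup>+\<theta>\<in>A. W \<theta> * ennreal (h \<theta> x) \<partial>\<pi>) powr \<rho>) \<partial>Q)
    \<le> ennreal (enn2real (\<integral>\<^sup>+\<theta>\<in>A. W \<theta> \<partial>\<pi>) powr \<rho> * \<alpha>)"
proof (cases "(\<integral>\<^sup>+\<theta>\<in>A. W \<theta> \<partial>\<pi>) = 0")
  case True
  then have "AE \<theta> in \<pi>. W \<theta> * indicator A \<theta> = 0" by (subst (asm) nn_integral_0_iff_AE) auto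
  then have "(\<integral>\<^sup>+\<theta>\<in>A. W \<theta> * ennreal (h \<theta> x) \<partial>\<pi>) = 0" if "x \<in> space Q" for x
    using that by (subst nn_integral_0_iff_AE) (auto simp: mult_ac)
  then have "(\<integral>\<^sup>+x. ennreal (enn2real (\<integral>\<^sup>+\<theta>\<in>A. W \<theta> * ennreal (h \<theta> x) \<partial>\<pi>) powr \<rho>) \<partial>Q)
      = (\<integral>\<^sup>+x. 0 \<partial>Q)" using \<rho> by (intro nn_integral_cong) simp
  then show ?thesis by simp
next
  case False
  define m where "m = enn2real (\<integral>\<^sup>+\<theta>\<in>A. W \<theta> \<partial>\<pi>)"
  have m: "(\<integral>\<^sup>+\<theta>\<in>A. W \<theta> \<partial>\<pi>) = ennreal m" "0 < m"
    using fin False by (auto simp: m_def enn2real_positive_iff less_top zero_less_iff_neq_zero)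
  define \<nu> where "\<nu> = density \<pi> (\<lambda>\<theta>. ennreal (1 / m) * (W \<theta> * indicator A \<theta>))"
  have "emeasure \<nu> (space \<nu>) = (\<integral>\<^sup>+\<theta>. ennreal (1 / m) * (W \<theta> * indicator A \<theta>) \<partial>\<pi>)"
    by (simp add: \<nu>_def emeasure_density mult.assoc cong: nn_integral_cong)
  also have "\<dots> = 1"
    using m by (simp add: nn_integral_cmult ennreal_mult[symmetric])
  finally have \<nu>: "prob_space \<nu>" by (rule prob_spaceI)
  have space_\<nu>: "space \<nu> = space \<pi>" and sets_\<nu>[measurable_cong]: "sets \<nu> = sets \<pi>" by (auto simp: \<nu>_def)
  have \<alpha>0: "0 \<le> \<alpha>"
  proof -
    obtain f where "f \<in> C" using C_ne by blast
    from \<alpha>[OF this] show ?thesis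
      by (rule order_trans[rotated]) (intro integral_nonneg_AE AE_I2, simp)
  qed
  have mix: "(\<integral>x. (\<integral>\<theta>. h \<theta> x \<partial>\<nu>) powr \<rho> \<partial>Q) \<le> \<alpha>"
  proof (rule affinity_of_mixture_le[where G=A and C=C])
    show "AE \<theta> in \<nu>. \<theta> \<in> A"
      unfolding \<nu>_def by (subst AE_density) (auto simp: indicator_def split: if_splits)
    show "(\<lambda>(\<theta>, x). h \<theta> x) \<in> borel_measurable (\<nu> \<Otimes>\<^sub>M Q)" 
      by (simp add: case_prod_unfold) 
  qed (use assms Q \<nu> h_nonneg h_mass space_\<nu> in auto)
  have hint: "integrable Q (\<lambda>x. \<integral>\<theta>. h \<theta> x \<partial>\<nu>)"
  proof -
    interpret N: prob_space \<nu> by (rule \<nu>)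
    interpret P: pair_prob_space \<nu> Q ..
    show ?thesis
      by (rule P.integrable_snd, rule integrable_density_family)
        (use Q \<nu> h_nonneg h_mass space_\<nu> in \<open>auto simp: case_prod_unfold\<close>)
  qed
  have eq: "enn2real (\<integral>\<^sup>+\<theta>\<in>A. W \<theta> * ennreal (h \<theta> x) \<partial>\<pi>) = m * (\<integral>\<theta>. h \<theta> x \<partial>\<nu>)"
    if x: "x \<in> space Q" for x
  proof -
    have "(\<integral>\<theta>. h \<theta> x \<partial>\<nu>) = enn2real (\<integral>\<^sup>+\<theta>. ennreal (h \<theta> x) \<partial>\<nu>)"
      using x h_nonneg space_\<nu> by (intro integral_eq_nn_integral) auto
    also have "(\<integral>\<^sup>+\<theta>. ennreal (h \<theta> x) \<partial>\<nu>)
        = (\<integral>\<^sup>+\<theta>. ennreal (1 / m) * (W \<theta> * ennreal (h \<theta> x) * indicator A \<theta>) \<partial>\<pi>)"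
      unfolding \<nu>_def using x by (subst nn_integral_density) (auto simp: mult_ac)
    also have "\<dots> = ennreal (1 / m) * (\<integral>\<^sup>+\<theta>\<in>A. W \<theta> * ennreal (h \<theta> x) \<partial>\<pi>)"
      using x by (intro nn_integral_cmult) auto
    finally show ?thesis using m(2) by (simp add: enn2real_mult)
  qed
  have H0: "0 \<le> (\<integral>\<theta>. h \<theta> x \<partial>\<nu>)" if "x \<in> space Q" for x
    using h_nonneg space_\<nu> that by (intro integral_nonneg_AE AE_I2) auto
  have "(\<integral>\<^sup>+x. ennreal (enn2real (\<integral>\<^sup>+\<theta>\<in>A. W \<theta> * ennreal (h \<theta> x) \<partial>\<pi>) powr \<rho>) \<partial>Q)
      = (\<integral>\<^sup>+x. ennreal (m powr \<rho>) * ennreal ((\<integral>\<theta>. h \<theta> x \<partial>\<nu>) powr \<rho>) \<partial>Q)"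
    using m(2) H0 by (intro nn_integral_cong) (simp add: eq powr_mult ennreal_mult)
  also have "\<dots> = ennreal (m powr \<rho>) * (\<integral>\<^sup>+x. ennreal ((\<integral>\<theta>. h \<theta> x \<partial>\<nu>) powr \<rho>) \<partial>Q)"
    using borel_measurable_integrable[OF hint] by (intro nn_integral_cmult) auto
  also have "\<dots> = ennreal (m powr \<rho>) * ennreal (\<integral>x. (\<integral>\<theta>. h \<theta> x \<partial>\<nu>) powr \<rho> \<partial>Q)"
    using hint H0 \<rho>
    by (subst nn_integral_eq_integral) (auto intro!: integrable_powr Q.finite_measure_axioms)
  also have "\<dots> \<le> ennreal (m powr \<rho>) * ennreal \<alpha>"
    using mix by (intro mult_left_mono ennreal_leI) auto
  also have "\<dots> = ennreal (m powr \<rho> * \<alpha>)" using \<alpha>0 by (simp add: ennreal_mult)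
  finally show ?thesis by (simp add: m_def)
qed

text \<open>The affinity tensorises: conditionally on the first \<open>n\<close> observations, the next one multiplies the
  bound by the affinity of a mixture over \<open>A\<close>, which is at most \<open>\<alpha>\<close>.\<close>

lemma evidence_affinity_le:
  assumes A[measurable]: "A \<in> sets \<pi>"
    and C_ne: "C \<noteq> {}"
    and C_int: "\<And>f. f \<in> C \<Longrightarrow> integrable Q f"
    and C_nonneg: "\<And>f x. f \<in> C \<Longrightarrow> x \<in> space Q \<Longrightarrow> 0 \<le> f x"
    and C_step: "\<And>f \<theta> t. f \<in> C \<Longrightarrow> \<theta> \<in> A \<Longrightarrow> 0 < t \<Longrightarrow> t < 1 \<Longrightarrow>
        \<exists>g\<in>C. \<forall>x\<in>space Q. g x = (1 - t) * f x + t * h \<theta> x"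
    and \<rho>: "0 < \<rho>" "\<rho> < 1"
    and \<alpha>: "\<And>f. f \<in> C \<Longrightarrow> (\<integral>x. f x powr \<rho> \<partial>Q) \<le> \<alpha>" "0 \<le> \<alpha>"
  shows "(\<integral>\<^sup>+X. ennreal (enn2real (evidence n A X) powr \<rho>) \<partial>samples n)
    \<le> ennreal (measure \<pi> A powr \<rho> * \<alpha> ^ n)"
proof (induction n)
  case 0
  interpret S: prob_space "samples 0" by (rule samples_prob_space)
  show ?case
    using S.emeasure_space_1
    by (simp add: evidence_def likelihood_def measure_def)
next
  case (Suc n)
  have "(\<integral>\<^sup>+X. ennreal (enn2real (evidence (Suc n) A X) powr \<rho>) \<partial>samples (Suc n))
      = (\<integral>\<^sup>+X. \<integral>\<^sup>+x. ennreal (enn2real (evidence (Suc n) A (X(n := x))) powr \<rho>) \<partial>Q \<partial>samples n)"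
    unfolding lessThan_Suc
    by (rule samples.product_nn_integral_insert)
      (use evidence_measurable[OF A, of "Suc n"] in \<open>auto simp: lessThan_Suc\<close>)
  also have "\<dots> = (\<integral>\<^sup>+X. \<integral>\<^sup>+x. ennreal (enn2real
      (\<integral>\<^sup>+\<theta>\<in>A. likelihood n h \<theta> X * ennreal (h \<theta> x) \<partial>\<pi>) powr \<rho>) \<partial>Q \<partial>samples n)"
    by (simp add: evidence_def likelihood_def lessThan_Suc mult.commute)
  also have "\<dots> \<le> (\<integral>\<^sup>+X. ennreal (enn2real (evidence n A X) powr \<rho> * \<alpha>) \<partial>samples n)"
  proof (rule nn_integral_mono_AE)
    show "AE X in samples n. (\<integral>\<^sup>+x. ennreal (enn2real
        (\<integral>\<^sup>+\<theta>\<in>A. likelihood n h \<theta> X * ennreal (h \<theta> x) \<partial>\<pi>) powr \<rho>) \<partial>Q)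
        \<le> ennreal (enn2real (evidence n A X) powr \<rho> * \<alpha>)"
      using evidence_finite_AE[OF A, of n] AE_space
    proof eventually_elim
      case (elim X)
      then show ?case
        unfolding evidence_def
        by (intro weighted_affinity_le[where C=C]) (use assms in auto)
    qed
  qed
  also have "\<dots> = (\<integral>\<^sup>+X. ennreal (enn2real (evidence n A X) powr \<rho>) * ennreal \<alpha> \<partial>samples n)"
    using \<alpha>(2) by (simp add: ennreal_mult)
  also have "\<dots> = (\<integral>\<^sup>+X. ennreal (enn2real (evidence n A X) powr \<rho>) \<partial>samples n) * ennreal \<alpha>"
    by (intro nn_integral_multc) auto
  also have "\<dots> \<le> ennreal (measure \<pi> A powr \<rho> * \<alpha> ^ n) * ennreal \<alpha>"
    by (intro mult_right_mono Suc.IH) simp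
  also have "\<dots> = ennreal (measure \<pi> A powr \<rho> * \<alpha> ^ Suc n)"
    using \<alpha>(2) by (simp add: ennreal_mult[symmetric] mult_ac)
  finally show ?case .
qed

end

section \<open>The expected logarithm of the evidence\<close>

context likelihood_ratios
begin

lemma
  fixes f :: "'a \<Rightarrow> real"
  assumes i: "i < n" and f[measurable]: "f \<in> borel_measurable Q"
  shows nn_integral_coordinate: "(\<integral>\<^sup>+X. ennreal (f (X i)) \<partial>samples n) = (\<integral>\<^sup>+x. ennreal (f x) \<partial>Q)"
    and integral_coordinate: "(\<integral>X. f (X i) \<partial>samples n) = (\<integral>x. f x \<partial>Q)"
    and integrable_coordinate: "integrable (samples n) (\<lambda>X. f (X i)) \<longleftrightarrow> integrable Q f"
proof -
  have d: "distr (samples n) Q (\<lambda>X. X i) = Q"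
    using i by (intro distr_PiM_component[where M="\<lambda>_. Q"]) (auto simp: Q)
  have [measurable]: "(\<lambda>X. X i) \<in> measurable (samples n) Q"
    using i by (intro measurable_component_singleton) auto
  show "(\<integral>\<^sup>+X. ennreal (f (X i)) \<partial>samples n) = (\<integral>\<^sup>+x. ennreal (f x) \<partial>Q)"
    by (subst (2) d[symmetric], subst nn_integral_distr) auto
  show "(\<integral>X. f (X i) \<partial>samples n) = (\<integral>x. f x \<partial>Q)"
    by (subst (2) d[symmetric], subst integral_distr) auto
  show "integrable (samples n) (\<lambda>X. f (X i)) \<longleftrightarrow> integrable Q f"
    by (subst (2) d[symmetric], subst integrable_distr_eq) auto
qed

text \<open>Gibbs variational principle. Let \<open>\<beta>\<close> be the probability measure with density
  \<open>exp (- n k) / b\<close> on \<open>T\<close> with respect to the prior. With \<open>S\<close> the evidence of the whole parameter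
  space, \<open>r = likelihood * exp (n k) * b / S\<close> has \<open>\<beta>\<close>-mean at most 1, so \<open>ln r \<le> r - 1\<close> shows
  \<open>ln S \<ge> ln b + \<integral>(n k + ln likelihood) d\<beta>\<close>. Taking expectations over the sample, \<open>n k\<close> dominates the
  mean of \<open>- ln likelihood\<close>. Exchanging the two integrals is legitimate because
  \<open>\<integral>\<bar>ln h\<bar> dQ \<le> k + 2\<close> and \<open>k\<close> is \<open>\<beta>\<close>-integrable, as \<open>k exp (- n k) \<le> 1\<close>.\<close>

lemma expected_log_evidence_ge:
  fixes k :: "'t \<Rightarrow> real"
  assumes n: "1 \<le> n"
    and T[measurable]: "T \<in> sets \<pi>" and k[measurable]: "k \<in> borel_measurable \<pi>"
    and k0: "\<And>\<theta>. \<theta> \<in> T \<Longrightarrow> 0 \<le> k \<theta>"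
    and h_pos: "\<And>\<theta>. \<theta> \<in> T \<Longrightarrow> AE x in Q. 0 < h \<theta> x"
    and ln_int: "\<And>\<theta>. \<theta> \<in> T \<Longrightarrow> integrable Q (\<lambda>x. ln (h \<theta> x))"
    and ln_ge: "\<And>\<theta>. \<theta> \<in> T \<Longrightarrow> - k \<theta> \<le> (\<integral>x. ln (h \<theta> x) \<partial>Q)"
    and ev: "AE X in samples n. 0 < evidence n (space \<pi>) X"
    and b: "(\<integral>\<^sup>+\<theta>\<in>T. ennreal (exp (- (real n * k \<theta>))) \<partial>\<pi>) = ennreal b" "0 < b"
  shows "integrable (samples n) (\<lambda>X. ln (enn2real (evidence n (space \<pi>) X)))"
    and "ln b \<le> (\<integral>X. ln (enn2real (evidence n (space \<pi>) X)) \<partial>samples n)"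
proof -
  define S where "S X = enn2real (evidence n (space \<pi>) X)" for X
  define e where "e \<theta> = exp (- (real n * k \<theta>)) / b * indicator T \<theta>" for \<theta>
  define \<beta> where "\<beta> = density \<pi> (\<lambda>\<theta>. ennreal (e \<theta>))"
  have e_meas[measurable]: "e \<in> borel_measurable \<pi>" unfolding e_def[abs_def] by measurable
  have e0: "0 \<le> e \<theta>" for \<theta> using b(2) by (simp add: e_def)
  have TS: "\<theta> \<in> space \<pi>" if "\<theta> \<in> T" for \<theta> using sets.sets_into_space[OF T] that by blast
  have [measurable]: "S \<in> borel_measurable (samples n)"
    unfolding S_def[abs_def] by measurable
  have "emeasure \<beta> (space \<beta>) = (\<integral>\<^sup>+\<theta>. ennreal (e \<theta>) \<partial>\<pi>)"
    by (simp add: \<beta>_def emeasure_density cong: nn_integral_cong)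
  also have "\<dots> = (\<integral>\<^sup>+\<theta>. ennreal (1 / b) * (ennreal (exp (- (real n * k \<theta>))) * indicator T \<theta>) \<partial>\<pi>)"
    using b(2) by (intro nn_integral_cong) (auto simp: e_def indicator_def ennreal_mult[symmetric])
  also have "\<dots> = 1"
    using b by (simp add: nn_integral_cmult ennreal_mult[symmetric])
  finally have \<beta>: "prob_space \<beta>" by (rule prob_spaceI)
  have space_\<beta>: "space \<beta> = space \<pi>" and sets_\<beta>[measurable_cong]: "sets \<beta> = sets \<pi>"
    by (auto simp: \<beta>_def)
  interpret S: prob_space "samples n" by (rule samples_prob_space)
  interpret N: prob_space \<beta> by (rule \<beta>)
  interpret P: pair_prob_space \<beta> "samples n" ..
  have T_AE: "AE \<theta> in \<beta>. \<theta> \<in> T"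
    unfolding \<beta>_def by (subst AE_density) (auto simp: e_def indicator_def split: if_splits)
  have kint: "integrable \<beta> k"
  proof (rule integrableI_bounded)
    have "(\<integral>\<^sup>+\<theta>. ennreal (norm (k \<theta>)) \<partial>\<beta>) = (\<integral>\<^sup>+\<theta>. ennreal (e \<theta>) * ennreal (norm (k \<theta>)) \<partial>\<pi>)"
      unfolding \<beta>_def by (subst nn_integral_density) auto
    also have "\<dots> \<le> (\<integral>\<^sup>+\<theta>. ennreal (1 / b) \<partial>\<pi>)"
    proof (rule nn_integral_mono)
      fix \<theta> assume "\<theta> \<in> space \<pi>"
      have "exp (- (real n * k \<theta>)) * k \<theta> \<le> 1" if "\<theta> \<in> T"
      proof -
        have "k \<theta> \<le> real n * k \<theta>" using n k0[OF that] mult_right_mono[of 1 "real n" "k \<theta>"] by simp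
        also have "\<dots> \<le> exp (real n * k \<theta>)" using exp_ge_add_one_self[of "real n * k \<theta>"] by linarith
        finally show ?thesis by (simp add: exp_minus field_simps)
      qed
      then have "e \<theta> * norm (k \<theta>) \<le> 1 / b"
        using b(2) k0[of \<theta>] by (auto simp: e_def indicator_def divide_right_mono)
      then show "ennreal (e \<theta>) * ennreal (norm (k \<theta>)) \<le> ennreal (1 / b)"
        using e0 by (simp add: ennreal_mult[symmetric] ennreal_leI)
    qed
    also have "\<dots> < \<infinity>" by (simp add: prior.emeasure_space_1)
    finally show "(\<integral>\<^sup>+\<theta>. ennreal (norm (k \<theta>)) \<partial>\<beta>) < \<infinity>" .
  qed simp
  define l where "l z = (\<Sum>i<n. ln (h (fst z) (snd z i)))" for z
  have coord[measurable (raw)]: "(\<lambda>z. g z i) \<in> measurable M Q" if "i < n" "g \<in> measurable M (samples n)" for i g and M :: "'z measure"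
    using measurable_compose[OF that(2) measurable_component_singleton[of i]] that by simp
  have comp_meas: "(\<lambda>z. h (fst z) (snd z i)) \<in> borel_measurable (\<beta> \<Otimes>\<^sub>M samples n)" if "i < n" for i
    using that by (intro h_measurable_comp coord) auto
  have l_meas[measurable]: "l \<in> borel_measurable (\<beta> \<Otimes>\<^sub>M samples n)"
    unfolding l_def[abs_def]
    by (intro borel_measurable_sum measurable_compose[OF comp_meas borel_measurable_ln] comp_meas) auto
  \<comment> \<open>\<open>\<bar>ln h\<bar> = 2 max 0 (ln h) - ln h\<close>, and the positive part of \<open>ln h\<close> is at most \<open>h\<close>.\<close>
  have abs_ln: "(\<integral>\<^sup>+x. ennreal \<bar>ln (h \<theta> x)\<bar> \<partial>Q) \<le> ennreal (k \<theta> + 2)" if \<theta>: "\<theta> \<in> T" for \<theta>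
  proof -
    have hi: "integrable Q (h \<theta>)" "(\<integral>x. h \<theta> x \<partial>Q) \<le> 1"
    proof -
      have fin: "(\<integral>\<^sup>+x. ennreal (h \<theta> x) \<partial>Q) \<le> 1" using h_mass TS \<theta> by blast
      show "integrable Q (h \<theta>)"
        using h_nonneg TS[OF \<theta>] fin
        by (intro integrableI_nonneg) (auto simp: le_less_trans[OF fin ennreal_one_less_top])
      have "(\<integral>x. h \<theta> x \<partial>Q) = enn2real (\<integral>\<^sup>+x. ennreal (h \<theta> x) \<partial>Q)"
        using h_nonneg TS[OF \<theta>] by (intro integral_eq_nn_integral) auto
      also have "\<dots> \<le> enn2real 1" using fin by (intro enn2real_mono) auto
      finally show "(\<integral>x. h \<theta> x \<partial>Q) \<le> 1" by simp
    qed
    have "(\<integral>x. \<bar>ln (h \<theta> x)\<bar> \<partial>Q) \<le> (\<integral>x. 2 * h \<theta> x - ln (h \<theta> x) \<partial>Q)"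
    proof (rule integral_mono_AE)
      show "AE x in Q. \<bar>ln (h \<theta> x)\<bar> \<le> 2 * h \<theta> x - ln (h \<theta> x)"
        using h_pos[OF \<theta>]
      proof eventually_elim
        case (elim x)
        then show ?case using ln_le_minus_one[of "h \<theta> x"] by linarith
      qed
    qed (use ln_int[OF \<theta>] hi in auto)
    also have "\<dots> = 2 * (\<integral>x. h \<theta> x \<partial>Q) - (\<integral>x. ln (h \<theta> x) \<partial>Q)"
      using ln_int[OF \<theta>] hi by simp
    also have "\<dots> \<le> k \<theta> + 2" using hi(2) ln_ge[OF \<theta>] by linarith
    finally show ?thesis
      using ln_int[OF \<theta>] by (subst nn_integral_eq_integral) (auto intro: ennreal_leI)
  qed
  have ln_meas: "(\<lambda>x. ln (h \<theta> x)) \<in> borel_measurable Q" if "\<theta> \<in> T" for \<theta>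
    using ln_int[OF that] by (rule borel_measurable_integrable)
  have lint: "integrable (\<beta> \<Otimes>\<^sub>M samples n) l"
  proof (rule integrableI_bounded)
    have "(\<integral>\<^sup>+z. ennreal (norm (l z)) \<partial>(\<beta> \<Otimes>\<^sub>M samples n))
        = (\<integral>\<^sup>+\<theta>. \<integral>\<^sup>+X. ennreal \<bar>l (\<theta>, X)\<bar> \<partial>samples n \<partial>\<beta>)"
      by (subst S.nn_integral_fst[symmetric]) auto
    also have "\<dots> \<le> (\<integral>\<^sup>+\<theta>. ennreal (real n * (\<bar>k \<theta>\<bar> + 2)) \<partial>\<beta>)"
    proof (rule nn_integral_mono_AE)
      show "AE \<theta> in \<beta>. (\<integral>\<^sup>+X. ennreal \<bar>l (\<theta>, X)\<bar> \<partial>samples n) \<le> ennreal (real n * (\<bar>k \<theta>\<bar> + 2))"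
        using T_AE
      proof eventually_elim
        case (elim \<theta>)
        have ln_coord: "(\<lambda>X. ln (h \<theta> (X i))) \<in> borel_measurable (samples n)" if "i < n" for i
          by (rule measurable_compose[where N=Q and g="\<lambda>x. ln (h \<theta> x)"])
            (use that coord ln_meas[OF elim] in auto)
        have "(\<integral>\<^sup>+X. ennreal \<bar>l (\<theta>, X)\<bar> \<partial>samples n)
            \<le> (\<integral>\<^sup>+X. (\<Sum>i<n. ennreal \<bar>ln (h \<theta> (X i))\<bar>) \<partial>samples n)"
          by (intro nn_integral_mono) (auto simp: l_def intro!: ennreal_leI sum_abs)
        also have "\<dots> = (\<Sum>i<n. \<integral>\<^sup>+X. ennreal \<bar>ln (h \<theta> (X i))\<bar> \<partial>samples n)"
          using ln_coord by (intro nn_integral_sum) auto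
        also have "\<dots> = (\<Sum>i<n. \<integral>\<^sup>+x. ennreal \<bar>ln (h \<theta> x)\<bar> \<partial>Q)"
          using ln_meas[OF elim] by (intro sum.cong nn_integral_coordinate refl) auto
        also have "\<dots> \<le> (\<Sum>i<n. ennreal (k \<theta> + 2))"
          by (intro sum_mono abs_ln elim)
        also have "\<dots> = ennreal (real n * (\<bar>k \<theta>\<bar> + 2))"
          using k0[OF elim] by (simp add: ennreal_mult ennreal_of_nat_eq_real_of_nat)
        finally show ?case .
      qed
    qed
    also have "\<dots> < \<infinity>"
    proof -
      have "integrable \<beta> (\<lambda>\<theta>. real n * (\<bar>k \<theta>\<bar> + 2))" using kint by auto
      then show ?thesis by (subst nn_integral_eq_integral) auto
    qed
    finally show "(\<integral>\<^sup>+z. ennreal (norm (l z)) \<partial>(\<beta> \<Otimes>\<^sub>M samples n)) < \<infinity>" .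
  qed simp
  define m where "m X = (\<integral>\<theta>. l (\<theta>, X) \<partial>\<beta>)" for X
  have mint: "integrable (samples n) m"
    using P.integrable_snd[of "\<lambda>\<theta> X. l (\<theta>, X)"] lint by (simp add: m_def[abs_def])
  have l_AE: "AE X in samples n. integrable \<beta> (\<lambda>\<theta>. l (\<theta>, X))"
    using P.AE_integrable_snd[of "\<lambda>\<theta> X. l (\<theta>, X)"] lint by simp
  have m_ge: "- (real n * (\<integral>\<theta>. k \<theta> \<partial>\<beta>)) \<le> (\<integral>X. m X \<partial>samples n)"
  proof -
    have "(\<integral>X. m X \<partial>samples n) = (\<integral>\<theta>. \<integral>X. l (\<theta>, X) \<partial>samples n \<partial>\<beta>)"
      unfolding m_def using P.Fubini_integral[of "\<lambda>\<theta> X. l (\<theta>, X)"] lint by simp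
    also have "(\<integral>\<theta>. - (real n * k \<theta>) \<partial>\<beta>) \<le> \<dots>"
    proof (rule integral_mono_AE)
      show "integrable \<beta> (\<lambda>\<theta>. \<integral>X. l (\<theta>, X) \<partial>samples n)" using P.integrable_fst'[OF lint] .
      show "AE \<theta> in \<beta>. - (real n * k \<theta>) \<le> (\<integral>X. l (\<theta>, X) \<partial>samples n)"
        using T_AE
      proof eventually_elim
        case (elim \<theta>)
        have "(\<integral>X. l (\<theta>, X) \<partial>samples n) = (\<Sum>i<n. \<integral>X. ln (h \<theta> (X i)) \<partial>samples n)"
          unfolding l_def using integrable_coordinate[OF _ ln_meas[OF elim]] ln_int[OF elim]
          by (simp add: Bochner_Integration.integral_sum)
        also have "\<dots> = real n * (\<integral>x. ln (h \<theta> x) \<partial>Q)"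
          using integral_coordinate[OF _ ln_meas[OF elim]] by simp
        finally show ?case using ln_ge[OF elim] mult_left_mono[of "- k \<theta>" _ "real n"] by simp
      qed
    qed (use kint in auto)
    finally show ?thesis by simp
  qed
  have pos_AE: "AE X in samples n. AE \<theta> in \<beta>. \<forall>i<n. 0 < h \<theta> (X i)"
  proof (subst P.AE_commute[symmetric])
    have "{z \<in> space (\<beta> \<Otimes>\<^sub>M samples n). \<forall>i<n. 0 < h (fst z) (snd z i)}
        = {z \<in> space (\<beta> \<Otimes>\<^sub>M samples n). \<forall>i\<in>{..<n}. 0 < h (fst z) (snd z i)}" by auto
    also have "\<dots> \<in> sets (\<beta> \<Otimes>\<^sub>M samples n)"
      by (intro sets.sets_Collect_finite_All borel_measurable_less comp_meas) auto
    finally show "{z \<in> space (\<beta> \<Otimes>\<^sub>M samples n). \<forall>i<n. 0 < h (fst z) (snd z i)}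
        \<in> sets (\<beta> \<Otimes>\<^sub>M samples n)" .
    show "AE \<theta> in \<beta>. AE X in samples n. \<forall>i<n. 0 < h \<theta> (X i)"
      using T_AE
    proof eventually_elim
      case (elim \<theta>)
      have "AE X in samples n. \<forall>i\<in>{..<n}. 0 < h \<theta> (X i)"
        using h_pos[OF elim] Q
        by (intro AE_finite_allI) (auto intro!: AE_PiM_component[where M="\<lambda>_. Q" and P="\<lambda>x. 0 < h \<theta> x"])
      then show ?case by eventually_elim auto
    qed
  qed
  have lnS: "AE X in samples n. ln b + real n * (\<integral>\<theta>. k \<theta> \<partial>\<beta>) + m X \<le> ln (S X)"
    using l_AE pos_AE ev evidence_finite_AE[OF sets.top[of \<pi>], of n] AE_space
  proof eventually_elim
    case (elim X)
    have SX: "0 < S X" "evidence n (space \<pi>) X = ennreal (S X)"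
      using elim by (auto simp: S_def enn2real_positive_iff)
    have Xi: "X i \<in> space Q" if "i < n" for i using elim(5) that by (auto simp: space_PiM)
    have [measurable]: "(\<lambda>\<theta>. h \<theta> (X i)) \<in> borel_measurable \<pi>" if "i < n" for i
      using Xi[OF that] by measurable
    define r where "r \<theta> = (\<Prod>i<n. h \<theta> (X i)) * (exp (real n * k \<theta>) * b / S X)" for \<theta>
    have [measurable]: "r \<in> borel_measurable \<pi>" unfolding r_def[abs_def] by measurable
    have r0: "0 \<le> r \<theta>" if "\<theta> \<in> space \<pi>" for \<theta>
      unfolding r_def using that h_nonneg Xi b(2) SX(1) by (intro mult_nonneg_nonneg prod_nonneg) auto
    have "(\<integral>\<^sup>+\<theta>. ennreal (r \<theta>) \<partial>\<beta>) = (\<integral>\<^sup>+\<theta>. ennreal (e \<theta>) * ennreal (r \<theta>) \<partial>\<pi>)"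
      unfolding \<beta>_def by (subst nn_integral_density) auto
    also have "\<dots> \<le> (\<integral>\<^sup>+\<theta>. ennreal (1 / S X) * (likelihood n h \<theta> X * indicator (space \<pi>) \<theta>) \<partial>\<pi>)"
    proof (rule nn_integral_mono)
      fix \<theta> assume \<theta>: "\<theta> \<in> space \<pi>"
      have lik: "likelihood n h \<theta> X = ennreal (\<Prod>i<n. h \<theta> (X i))"
        unfolding likelihood_def using h_nonneg[OF \<theta>] Xi by (intro prod_ennreal) auto
      have p0: "0 \<le> (\<Prod>i<n. h \<theta> (X i))" using h_nonneg[OF \<theta>] Xi by (intro prod_nonneg) auto
      have "e \<theta> * r \<theta> \<le> 1 / S X * (\<Prod>i<n. h \<theta> (X i))"
        using p0 b(2) SX(1) by (auto simp: e_def r_def indicator_def exp_minus field_simps)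
      then show "ennreal (e \<theta>) * ennreal (r \<theta>)
          \<le> ennreal (1 / S X) * (likelihood n h \<theta> X * indicator (space \<pi>) \<theta>)"
        unfolding lik using \<theta> p0 SX(1) e0 r0[OF \<theta>]
        by (simp add: ennreal_mult[symmetric] ennreal_leI)
    qed
    also have "\<dots> = ennreal (1 / S X) * evidence n (space \<pi>) X"
      unfolding evidence_def using elim(5) by (intro nn_integral_cmult) measurable
    also have "\<dots> = 1" using SX by (simp add: ennreal_mult[symmetric])
    finally have r1: "(\<integral>\<^sup>+\<theta>. ennreal (r \<theta>) \<partial>\<beta>) \<le> 1" .
    have ri: "integrable \<beta> r"
      using r0 space_\<beta> by (intro integrableI_nonneg) (auto simp: le_less_trans[OF r1 ennreal_one_less_top])
    have "(\<integral>\<theta>. r \<theta> \<partial>\<beta>) = enn2real (\<integral>\<^sup>+\<theta>. ennreal (r \<theta>) \<partial>\<beta>)"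
      using r0 space_\<beta> by (intro integral_eq_nn_integral) auto
    also have "\<dots> \<le> enn2real 1" using r1 by (intro enn2real_mono) auto
    finally have r2: "(\<integral>\<theta>. r \<theta> \<partial>\<beta>) \<le> 1" by simp
    have "(\<integral>\<theta>. l (\<theta>, X) + real n * k \<theta> + (ln b - ln (S X) + 1) \<partial>\<beta>) \<le> (\<integral>\<theta>. r \<theta> \<partial>\<beta>)"
    proof (rule integral_mono_AE)
      show "AE \<theta> in \<beta>. l (\<theta>, X) + real n * k \<theta> + (ln b - ln (S X) + 1) \<le> r \<theta>"
        using elim(2)
      proof eventually_elim
        case (elim \<theta>)
        have p: "0 < (\<Prod>i<n. h \<theta> (X i))" using elim by (intro prod_pos) auto
        have ln_prod4: "ln (x * (exp a * y / s)) = ln x + a + ln y - ln s"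
          if "0 < x" "0 < y" "0 < s" for x a y s :: real
          using that by (simp add: ln_mult ln_div)
        have lp: "ln (\<Prod>i<n. h \<theta> (X i)) = (\<Sum>i<n. ln (h \<theta> (X i)))"
          using elim by (intro ln_prod) auto
        have "ln (r \<theta>) = l (\<theta>, X) + real n * k \<theta> + ln b - ln (S X)"
          using ln_prod4[OF p b(2) SX(1), of "real n * k \<theta>"] lp by (simp add: r_def l_def)
        moreover have "ln (r \<theta>) \<le> r \<theta> - 1"
          using p b(2) SX(1) by (intro ln_le_minus_one) (simp add: r_def)
        ultimately show ?case by simp
      qed
    qed (use elim(1) kint ri in auto)
    then show ?case
      using elim(1) kint r2 by (simp add: m_def N.prob_space)
  qed
  have Sint: "integrable (samples n) S"
  proof (rule integrableI_nonneg)
    have "(\<integral>\<^sup>+X. ennreal (S X) \<partial>samples n) \<le> (\<integral>\<^sup>+X. evidence n (space \<pi>) X \<partial>samples n)"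
      by (intro nn_integral_mono) (simp add: S_def ennreal_enn2real_if)
    also have "\<dots> \<le> 1" using evidence_mass[OF sets.top[of \<pi>], of n] by (simp add: prior.emeasure_space_1)
    finally show "(\<integral>\<^sup>+X. ennreal (S X) \<partial>samples n) < \<infinity>"
      using ennreal_one_less_top le_less_trans by (metis infinity_ennreal_def)
  qed (auto simp: S_def)
  have low: "integrable (samples n) (\<lambda>X. ln b + real n * (\<integral>\<theta>. k \<theta> \<partial>\<beta>) + m X)" using mint by auto
  \<comment> \<open>Bounded below by the integrable function just found, and above by \<open>S\<close> itself.\<close>
  have lnSint: "integrable (samples n) (\<lambda>X. ln (S X))"
  proof (rule Bochner_Integration.integrable_bound[where
        f="\<lambda>X. \<bar>S X\<bar> + \<bar>ln b + real n * (\<integral>\<theta>. k \<theta> \<partial>\<beta>) + m X\<bar>"])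
    show "AE X in samples n. norm (ln (S X)) \<le> norm (\<bar>S X\<bar> + \<bar>ln b + real n * (\<integral>\<theta>. k \<theta> \<partial>\<beta>) + m X\<bar>)"
      using lnS
    proof eventually_elim
      case (elim X)
      have "ln (S X) \<le> \<bar>S X\<bar>"
      proof (cases "S X = 0")
        case False
        moreover have "0 \<le> S X" by (simp add: S_def)
        ultimately show ?thesis using ln_le_minus_one[of "S X"] by simp
      qed simp
      then show ?case using elim unfolding real_norm_def by linarith
    qed
  qed (use Sint low in auto)
  then show "integrable (samples n) (\<lambda>X. ln (enn2real (evidence n (space \<pi>) X)))" by (simp add: S_def)
  have "ln b \<le> ln b + real n * (\<integral>\<theta>. k \<theta> \<partial>\<beta>) + (\<integral>X. m X \<partial>samples n)" using m_ge by simp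
  also have "\<dots> = (\<integral>X. ln b + real n * (\<integral>\<theta>. k \<theta> \<partial>\<beta>) + m X \<partial>samples n)"
    using mint by (simp add: S.prob_space)
  also have "\<dots> \<le> (\<integral>X. ln (S X) \<partial>samples n)"
    by (rule integral_mono_AE[OF low lnSint lnS])
  finally show "ln b \<le> (\<integral>X. ln (enn2real (evidence n (space \<pi>) X)) \<partial>samples n)" by (simp add: S_def)
qed

end

section \<open>The expected posterior cost\<close>

lemma nn_integral_partition:
  assumes J: "countable J" and \<Gamma>: "\<And>j. j \<in> J \<Longrightarrow> \<Gamma> j \<in> sets M"
    and disj: "disjoint_family_on \<Gamma> J" and cover: "(\<Union>j\<in>J. \<Gamma> j) = space M"
    and W[measurable]: "W \<in> borel_measurable M"
  shows "(\<integral>\<^sup>+j. (\<integral>\<^sup>+\<theta>\<in>\<Gamma> j. W \<theta> \<partial>M) \<partial>count_space J) = (\<integral>\<^sup>+\<theta>. W \<theta> \<partial>M)"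
proof -
  have "(\<integral>\<^sup>+j. (\<integral>\<^sup>+\<theta>\<in>\<Gamma> j. W \<theta> \<partial>M) \<partial>count_space J)
      = (\<integral>\<^sup>+\<theta>. (\<integral>\<^sup>+j. W \<theta> * indicator (\<Gamma> j) \<theta> \<partial>count_space J) \<partial>M)"
    using J \<Gamma> by (intro nn_integral_count_space_nn_integral[symmetric]) auto
  also have "\<dots> = (\<integral>\<^sup>+\<theta>. W \<theta> \<partial>M)"
  proof (rule nn_integral_cong)
    fix \<theta> assume "\<theta> \<in> space M"
    then obtain i where i: "i \<in> J" "\<theta> \<in> \<Gamma> i" using cover by blast
    have "(\<integral>\<^sup>+j. W \<theta> * indicator (\<Gamma> j) \<theta> \<partial>count_space J) = (\<Sum>j\<in>{i}. W \<theta> * indicator (\<Gamma> j) \<theta>)"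
      using disj i unfolding disjoint_family_on_def by (intro nn_integral_count_space') (auto simp: indicator_def)
    then show "(\<integral>\<^sup>+j. W \<theta> * indicator (\<Gamma> j) \<theta> \<partial>count_space J) = W \<theta>" using i by simp
  qed
  finally show ?thesis .
qed

lemma borel_measurable_nn_integral_count_space:
  assumes "countable J" "\<And>j. j \<in> J \<Longrightarrow> f j \<in> borel_measurable M"
  shows "(\<lambda>x. \<integral>\<^sup>+j. f j x \<partial>count_space J) \<in> borel_measurable M"
proof -
  interpret sigma_finite_measure "count_space J"
    using assms(1) by (rule sigma_finite_measure_count_space_countable)
  show ?thesis
  proof (rule borel_measurable_nn_integral)
    have "(\<lambda>z. f (snd z) (fst z)) \<in> borel_measurable (M \<Otimes>\<^sub>M count_space J)"
      by (rule measurable_compose_countable'[where f="\<lambda>j z. f j (fst z)" and g=snd and I=J])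
        (use assms in auto)
    then show "(\<lambda>(x, j). f j x) \<in> borel_measurable (M \<Otimes>\<^sub>M count_space J)"
      by (simp add: case_prod_unfold)
  qed
qed

text \<open>One cell of the partition: \<open>N\<close> is its evidence, \<open>P\<close> its prior mass, \<open>s\<close> the total evidence and
  \<open>w = N / s\<close> its posterior weight. The exponents of \<open>P\<close> on the right are chosen so that \<open>ln P\<close> cancels
  after the two logarithms are bounded by tangents, since \<open>(\<gamma> - \<rho>) (\<kappa> - 1) = \<rho> - 1\<close>. What is left over is
  \<open>- (1 - \<rho>) w ln w\<close>, which is nonnegative because \<open>w \<le> 1\<close>.\<close>

lemma posterior_tangent_bound:
  fixes N P s a c \<rho> \<gamma> :: real
  assumes N: "0 \<le> N" "N \<le> s" and s: "0 < s" and P: "0 < P" and a: "0 < a"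
    and \<rho>: "0 < \<rho>" "\<rho> < 1" and \<gamma>: "1 \<le> \<gamma>"
  defines "\<kappa> \<equiv> (\<gamma> - 1) / (\<gamma> - \<rho>)"
  shows "N / s * (c + (1 + \<gamma> - \<rho> + \<gamma> * ln s - (\<gamma> - \<rho>) * ln a))
    \<le> exp c * P powr (1 - \<rho>) * N powr \<rho> + (\<gamma> - \<rho>) / a * P powr (\<kappa> - 1) * N"
proof (cases "N = 0")
  case False
  then have N0: "0 < N" using N by simp
  define w where "w = N / s"
  have w: "0 < w" "w \<le> 1" using N N0 s by (auto simp: w_def)
  have tangent: "w * (ln y - ln w) \<le> y - w" if "0 < y" for y
  proof -
    have "ln (y / w) \<le> y / w - 1" using that w by (intro ln_le_minus_one) auto
    then have "w * ln (y / w) \<le> w * (y / w - 1)" using w by (intro mult_left_mono) auto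
    then show ?thesis using that w by (simp add: ln_div right_diff_distrib)
  qed
  define u where "u = exp c * P powr (1 - \<rho>) * N powr \<rho>"
  define v where "v = P powr (\<kappa> - 1) * N / a"
  have u: "0 < u" "ln u = c + (1 - \<rho>) * ln P + \<rho> * ln N"
    using P N0 by (auto simp: u_def ln_mult ln_powr)
  have v: "0 < v" "ln v = (\<kappa> - 1) * ln P + ln N - ln a"
    using P N0 a by (auto simp: v_def ln_mult ln_powr ln_div)
  have lnN: "ln N = ln w + ln s" using N0 s by (simp add: w_def ln_div)
  have \<kappa>: "(\<gamma> - \<rho>) * (\<kappa> - 1) = \<rho> - 1"
    using \<rho> \<gamma> by (simp add: \<kappa>_def field_simps)
  have "w * (ln u - ln w) + (\<gamma> - \<rho>) * (w * (ln v - ln w)) \<le> (u - w) + (\<gamma> - \<rho>) * (v - w)"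
    using tangent[OF u(1)] tangent[OF v(1)] \<rho> \<gamma> by (intro add_mono mult_left_mono) auto
  also have "w * (ln u - ln w) + (\<gamma> - \<rho>) * (w * (ln v - ln w))
      = w * (c + (1 - \<rho>) * ln P + \<rho> * ln N - ln w + (\<gamma> - \<rho>) * (\<kappa> - 1) * ln P
          + (\<gamma> - \<rho>) * (ln N - ln a - ln w))"
    unfolding u(2) v(2) by (simp add: algebra_simps)
  also have "\<dots> = w * (c + \<gamma> * ln s - (\<gamma> - \<rho>) * ln a) - (1 - \<rho>) * w * ln w"
    unfolding \<kappa> lnN by (simp add: algebra_simps)
  finally have "w * (c + \<gamma> * ln s - (\<gamma> - \<rho>) * ln a) - (1 - \<rho>) * w * ln w + (1 + \<gamma> - \<rho>) * w
      \<le> u + (\<gamma> - \<rho>) * v" by (simp add: algebra_simps)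
  moreover have "(1 - \<rho>) * w * ln w \<le> 0"
    using w \<rho> by (intro mult_nonneg_nonpos) auto
  ultimately have "w * (c + (1 + \<gamma> - \<rho> + \<gamma> * ln s - (\<gamma> - \<rho>) * ln a)) \<le> u + (\<gamma> - \<rho>) * v"
    by (simp add: algebra_simps)
  then show ?thesis by (simp add: u_def v_def w_def mult_ac)
qed simp

context likelihood_ratios
begin

text \<open>The tangent bound is summed over the cells and integrated over the sample. With \<open>a\<close> as
  point of tangency the two terms on its right contribute at most \<open>1\<close> and \<open>\<gamma> - \<rho>\<close>, which cancel against
  the constant \<open>1 + \<gamma> - \<rho>\<close> on its left. A cell of infinite cost has evidence
  zero almost surely, so its term vanishes.\<close>

lemma expected_posterior_cost_le:
  fixes c :: "'j \<Rightarrow> ennreal" and a \<rho> \<gamma> :: real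
  assumes J: "countable J" and \<Gamma>: "\<And>j. j \<in> J \<Longrightarrow> \<Gamma> j \<in> sets \<pi>"
    and disj: "disjoint_family_on \<Gamma> J" and cover: "(\<Union>j\<in>J. \<Gamma> j) = space \<pi>"
    and \<rho>: "0 < \<rho>" "\<rho> < 1" and \<gamma>: "1 \<le> \<gamma>"
    and ev: "AE X in samples n. 0 < evidence n (space \<pi>) X"
    and ln_ev: "integrable (samples n) (\<lambda>X. ln (enn2real (evidence n (space \<pi>) X)))"
    and c_fin: "\<And>j. j \<in> J \<Longrightarrow> c j < \<top> \<Longrightarrow>
        (\<integral>\<^sup>+X. ennreal (enn2real (evidence n (\<Gamma> j) X) powr \<rho>) \<partial>samples n)
        \<le> ennreal (measure \<pi> (\<Gamma> j) powr \<rho> * exp (- enn2real (c j)))"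
    and c_inf: "\<And>j. j \<in> J \<Longrightarrow> c j = \<top> \<Longrightarrow> AE X in samples n. evidence n (\<Gamma> j) X = 0"
    and a: "0 < a" "(\<integral>\<^sup>+j. ennreal (measure \<pi> (\<Gamma> j) powr ((\<gamma> - 1) / (\<gamma> - \<rho>))) \<partial>count_space J) = ennreal a"
  shows "enn2ereal (\<integral>\<^sup>+X. (\<integral>\<^sup>+j. evidence n (\<Gamma> j) X / evidence n (space \<pi>) X * c j \<partial>count_space J) \<partial>samples n)
    \<le> ereal ((\<gamma> - \<rho>) * ln a - \<gamma> * (\<integral>X. ln (enn2real (evidence n (space \<pi>) X)) \<partial>samples n))"
proof -
  interpret S: prob_space "samples n" by (rule samples_prob_space)
  define s where "s X = evidence n (space \<pi>) X" for X
  define P where "P j = measure \<pi> (\<Gamma> j)" for j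
  define \<kappa> where "\<kappa> = (\<gamma> - 1) / (\<gamma> - \<rho>)"
  define m where "m X = 1 + \<gamma> - \<rho> + \<gamma> * ln (enn2real (s X)) - (\<gamma> - \<rho>) * ln a" for X
  define w where "w j X = evidence n (\<Gamma> j) X / s X" for j X
  define u where "u j X = (if c j = \<top> then 0 else ennreal (exp (enn2real (c j)) * P j powr (1 - \<rho>))
      * ennreal (enn2real (evidence n (\<Gamma> j) X) powr \<rho>))" for j X
  define v where "v j X = ennreal ((\<gamma> - \<rho>) / a * P j powr (\<kappa> - 1)) * evidence n (\<Gamma> j) X" for j X
  have e_meas[measurable]: "evidence n (\<Gamma> j) \<in> borel_measurable (samples n)" if "j \<in> J" for j
    by (rule evidence_measurable[OF \<Gamma>[OF that]])
  have [measurable]: "s \<in> borel_measurable (samples n)" unfolding s_def[abs_def] by measurable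
  have mint: "integrable (samples n) m" unfolding m_def[abs_def] s_def using ln_ev by auto
  have [measurable]: "m \<in> borel_measurable (samples n)" using mint by simp
  have w_meas[measurable]: "w j \<in> borel_measurable (samples n)" if "j \<in> J" for j
    unfolding w_def[abs_def] using e_meas[OF that] by measurable
  have u_meas[measurable]: "u j \<in> borel_measurable (samples n)" if "j \<in> J" for j
    unfolding u_def[abs_def] using e_meas[OF that] by measurable
  have v_meas[measurable]: "v j \<in> borel_measurable (samples n)" if "j \<in> J" for j
    unfolding v_def[abs_def] using e_meas[OF that] by measurable
  have sum_ev: "(\<integral>\<^sup>+j. evidence n (\<Gamma> j) X \<partial>count_space J) = s X" if "X \<in> space (samples n)" for X
  proof -
    have "s X = (\<integral>\<^sup>+\<theta>. likelihood n h \<theta> X \<partial>\<pi>)"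
      unfolding s_def evidence_def by (intro nn_integral_cong) simp
    then show ?thesis
      unfolding evidence_def using that
      by (simp add: nn_integral_partition[OF J \<Gamma> disj cover])
  qed
  have sum_P: "(\<integral>\<^sup>+j. ennreal (P j) \<partial>count_space J) = 1"
  proof -
    have "(\<integral>\<^sup>+j. ennreal (P j) \<partial>count_space J) = (\<integral>\<^sup>+j. (\<integral>\<^sup>+\<theta>\<in>\<Gamma> j. 1 \<partial>\<pi>) \<partial>count_space J)"
      using \<Gamma> by (intro nn_integral_cong) (simp add: P_def prior.emeasure_eq_measure)
    also have "\<dots> = 1"
      by (subst nn_integral_partition[OF J \<Gamma> disj cover]) (auto simp: prior.emeasure_space_1)
    finally show ?thesis .
  qed
  have inf_AE: "AE X in samples n. \<forall>j\<in>J. c j = \<top> \<longrightarrow> evidence n (\<Gamma> j) X = 0"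
    using c_inf J by (subst AE_ball_countable) auto
  have null: "evidence n (\<Gamma> j) X = 0" if "P j = 0" "j \<in> J" "X \<in> space (samples n)" for j X
  proof -
    have "AE \<theta> in \<pi>. \<theta> \<notin> \<Gamma> j"
      using that(1) \<Gamma>[OF that(2)] 
      by (intro AE_not_in) (simp add: null_sets_def P_def prior.emeasure_eq_measure)
    then show ?thesis
      unfolding evidence_def using that(3) \<Gamma>[OF that(2)]
      by (subst nn_integral_0_iff_AE) (auto elim!: eventually_mono)
  qed
  \<comment> \<open>The positive and the negative part of \<open>m X\<close> stand on opposite sides, so that sums and
    expectations can be taken in the extended nonnegative reals.\<close>
  have termwise: "AE X in samples n. \<forall>j\<in>J. w j X * c j + w j X * ennreal (m X)
      \<le> u j X + v j X + w j X * ennreal (- m X)"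
    using ev evidence_finite_AE[OF sets.top[of \<pi>], of n] inf_AE AE_space
  proof eventually_elim
    case (elim X)
    define S where "S = enn2real (s X)"
    have S: "0 < S" "s X = ennreal S" using elim by (auto simp: S_def s_def enn2real_positive_iff)
    show ?case
    proof
      fix j assume j: "j \<in> J"
      show "w j X * c j + w j X * ennreal (m X) \<le> u j X + v j X + w j X * ennreal (- m X)"
      proof (cases "c j = \<top> \<or> P j = 0")
        case True
        then have "evidence n (\<Gamma> j) X = 0" using elim(3,4) j null by blast
        then have "w j X = 0" by (simp add: w_def)
        then show ?thesis by simp
      next
        case False
        define N where "N = enn2real (evidence n (\<Gamma> j) X)"
        define d where "d = enn2real (c j)"
        have "evidence n (\<Gamma> j) X \<le> s X"
          unfolding evidence_def s_def using sets.sets_into_space[OF \<Gamma>[OF j]]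
          by (intro nn_integral_mono) (auto simp: indicator_def)
        then have N: "0 \<le> N" "N \<le> S" "evidence n (\<Gamma> j) X = ennreal N"
          using S by (auto simp: N_def enn2real_leI intro!: ennreal_enn2real[symmetric]
              intro: le_less_trans[OF _ ennreal_less_top])
        have d: "c j = ennreal d" "0 \<le> d" using False by (auto simp: d_def less_top)
        have Pj: "0 < P j" using False by (simp add: P_def measure_nonneg less_le)
        have wj: "w j X = ennreal (N / S)" by (simp add: w_def N S divide_ennreal)
        have ws: "0 \<le> N / S" using N S by simp
        have "N / S * (d + m X) \<le> exp d * P j powr (1 - \<rho>) * N powr \<rho> + (\<gamma> - \<rho>) / a * P j powr (\<kappa> - 1) * N"
          unfolding m_def S_def[symmetric] \<kappa>_def
          by (rule posterior_tangent_bound) (use N S Pj a \<rho> \<gamma> in auto)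
        moreover have "max 0 (m X) = m X + max 0 (- m X)" by auto
        ultimately have "N / S * d + N / S * max 0 (m X) \<le> exp d * P j powr (1 - \<rho>) * N powr \<rho>
            + (\<gamma> - \<rho>) / a * P j powr (\<kappa> - 1) * N + N / S * max 0 (- m X)"
          by (simp only: distrib_left)
        then have "ennreal (N / S * d + N / S * max 0 (m X)) \<le> ennreal (exp d * P j powr (1 - \<rho>) * N powr \<rho>
            + (\<gamma> - \<rho>) / a * P j powr (\<kappa> - 1) * N + N / S * max 0 (- m X))"
          by (rule ennreal_leI)
        moreover have "ennreal (N / S * d + N / S * max 0 (m X)) = w j X * c j + w j X * ennreal (m X)"
          using ws d(2) by (simp only: wj d(1) ennreal_plus ennreal_mult mult_nonneg_nonneg max.cobounded1 ennreal_max_0)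
        moreover have "ennreal (exp d * P j powr (1 - \<rho>) * N powr \<rho>
            + (\<gamma> - \<rho>) / a * P j powr (\<kappa> - 1) * N + N / S * max 0 (- m X))
            = u j X + v j X + w j X * ennreal (- m X)"
        proof -
          have "0 \<le> (\<gamma> - \<rho>) / a * P j powr (\<kappa> - 1)" using a \<rho> \<gamma> by simp
          moreover have "c j \<noteq> \<top>" using False by blast
          ultimately show ?thesis
            using ws N(1) unfolding u_def v_def wj N(3) d_def[symmetric] N_def[symmetric]
            by (simp only: ennreal_plus ennreal_mult mult_nonneg_nonneg max.cobounded1 ennreal_max_0
                exp_ge_zero powr_ge_zero add_nonneg_nonneg if_False simp_thms enn2real_ennreal)
        qed
        ultimately show ?thesis by simp
      qed
    qed
  qed
  define F where "F X = (\<integral>\<^sup>+j. w j X * c j \<partial>count_space J)" for X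
  define U where "U X = (\<integral>\<^sup>+j. u j X \<partial>count_space J)" for X
  define V where "V X = (\<integral>\<^sup>+j. v j X \<partial>count_space J)" for X
  have [measurable]: "F \<in> borel_measurable (samples n)" "U \<in> borel_measurable (samples n)"
    "V \<in> borel_measurable (samples n)"
    unfolding F_def[abs_def] U_def[abs_def] V_def[abs_def]
    using w_meas by (intro borel_measurable_nn_integral_count_space J; simp)+
  have summed: "AE X in samples n. F X + ennreal (m X) \<le> U X + V X + ennreal (- m X)"
    using termwise ev evidence_finite_AE[OF sets.top[of \<pi>], of n] AE_space
  proof eventually_elim
    case (elim X)
    have "(\<integral>\<^sup>+j. w j X \<partial>count_space J) = (\<integral>\<^sup>+j. evidence n (\<Gamma> j) X \<partial>count_space J) / s X"
      unfolding w_def by (rule nn_integral_divide) simp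
    also have "\<dots> = 1"
      using elim by (simp add: sum_ev s_def ennreal_divide_self less_top)
    finally have w1: "(\<integral>\<^sup>+j. w j X \<partial>count_space J) = 1" .
    have "F X + ennreal (m X) = (\<integral>\<^sup>+j. w j X * c j + w j X * ennreal (m X) \<partial>count_space J)"
      by (simp add: nn_integral_add nn_integral_multc F_def w1)
    also have "\<dots> \<le> (\<integral>\<^sup>+j. u j X + v j X + w j X * ennreal (- m X) \<partial>count_space J)"
      using elim(1) by (intro nn_integral_mono) auto
    also have "\<dots> = U X + V X + ennreal (- m X)"
      by (simp add: nn_integral_add nn_integral_multc U_def V_def w1)
    finally show ?case .
  qed
  have EU: "(\<integral>\<^sup>+X. U X \<partial>samples n) \<le> 1"
  proof -
    have "(\<integral>\<^sup>+X. U X \<partial>samples n) = (\<integral>\<^sup>+j. \<integral>\<^sup>+X. u j X \<partial>samples n \<partial>count_space J)"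
      unfolding U_def by (rule nn_integral_count_space_nn_integral[OF J u_meas])
    also have "\<dots> \<le> (\<integral>\<^sup>+j. ennreal (P j) \<partial>count_space J)"
    proof (rule nn_integral_mono)
      fix j assume "j \<in> space (count_space J)"
      then have j: "j \<in> J" by simp
      show "(\<integral>\<^sup>+X. u j X \<partial>samples n) \<le> ennreal (P j)"
      proof (cases "c j = \<top>")
        case False
        define d where "d = enn2real (c j)"
        have "(\<integral>\<^sup>+X. u j X \<partial>samples n) = ennreal (exp d * P j powr (1 - \<rho>)) *
            (\<integral>\<^sup>+X. ennreal (enn2real (evidence n (\<Gamma> j) X) powr \<rho>) \<partial>samples n)"
          unfolding u_def d_def using False e_meas[OF j] by (simp add: nn_integral_cmult)
        also have "\<dots> \<le> ennreal (exp d * P j powr (1 - \<rho>)) * ennreal (P j powr \<rho> * exp (- d))"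
          using c_fin[OF j] False by (intro mult_left_mono) (auto simp: d_def P_def less_top)
        also have "\<dots> = ennreal ((exp d * exp (- d)) * (P j powr (1 - \<rho>) * P j powr \<rho>))"
          by (simp add: ennreal_mult[symmetric] mult_ac)
        also have "\<dots> = ennreal (P j)"
          by (simp add: exp_minus powr_add[symmetric] P_def measure_nonneg)
        finally show ?thesis .
      qed (simp add: u_def)
    qed
    finally show ?thesis by (simp add: sum_P)
  qed
  have EV: "(\<integral>\<^sup>+X. V X \<partial>samples n) \<le> ennreal (\<gamma> - \<rho>)"
  proof -
    have "(\<integral>\<^sup>+X. V X \<partial>samples n) = (\<integral>\<^sup>+j. \<integral>\<^sup>+X. v j X \<partial>samples n \<partial>count_space J)"
      unfolding V_def by (rule nn_integral_count_space_nn_integral[OF J v_meas])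
    also have "\<dots> \<le> (\<integral>\<^sup>+j. ennreal ((\<gamma> - \<rho>) / a) * ennreal (P j powr \<kappa>) \<partial>count_space J)"
    proof (rule nn_integral_mono)
      fix j assume "j \<in> space (count_space J)"
      then have j: "j \<in> J" by simp
      have "(\<integral>\<^sup>+X. v j X \<partial>samples n) = ennreal ((\<gamma> - \<rho>) / a * P j powr (\<kappa> - 1)) *
          (\<integral>\<^sup>+X. evidence n (\<Gamma> j) X \<partial>samples n)"
        unfolding v_def using e_meas[OF j] by (simp add: nn_integral_cmult)
      also have "\<dots> \<le> ennreal ((\<gamma> - \<rho>) / a * P j powr (\<kappa> - 1)) * ennreal (P j)"
        using evidence_mass[OF \<Gamma>[OF j], of n]
        by (intro mult_left_mono) (auto simp: P_def prior.emeasure_eq_measure)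
      also have "\<dots> = ennreal ((\<gamma> - \<rho>) / a) * ennreal (P j powr (\<kappa> - 1) * P j)"
        using a \<rho> \<gamma> by (simp add: ennreal_mult[symmetric] P_def mult_ac)
      also have "P j powr (\<kappa> - 1) * P j = P j powr \<kappa>"
        using powr_add[of "P j" "\<kappa> - 1" 1] by (simp add: P_def measure_nonneg)
      finally show "(\<integral>\<^sup>+X. v j X \<partial>samples n) \<le> ennreal ((\<gamma> - \<rho>) / a) * ennreal (P j powr \<kappa>)" .
    qed
    also have "\<dots> = ennreal ((\<gamma> - \<rho>) / a) * ennreal a"
      using a(2) by (simp add: nn_integral_cmult P_def \<kappa>_def)
    also have "\<dots> = ennreal (\<gamma> - \<rho>)" using a(1) \<rho> \<gamma> by (simp add: ennreal_mult[symmetric])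
    finally show ?thesis .
  qed
  define r1 where "r1 = enn2real (\<integral>\<^sup>+X. ennreal (m X) \<partial>samples n)"
  define r2 where "r2 = enn2real (\<integral>\<^sup>+X. ennreal (- m X) \<partial>samples n)"
  have r1: "(\<integral>\<^sup>+X. ennreal (m X) \<partial>samples n) = ennreal r1" "0 \<le> r1"
    and r2: "(\<integral>\<^sup>+X. ennreal (- m X) \<partial>samples n) = ennreal r2" "0 \<le> r2"
    using mint unfolding real_integrable_def r1_def r2_def by (auto simp: less_top)
  have r12: "(\<integral>X. m X \<partial>samples n) = r1 - r2"
    unfolding r1_def r2_def by (rule real_lebesgue_integral_def[OF mint])
  have "(\<integral>\<^sup>+X. F X \<partial>samples n) + ennreal r1 = (\<integral>\<^sup>+X. F X + ennreal (m X) \<partial>samples n)"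
    by (simp add: nn_integral_add r1)
  also have "\<dots> \<le> (\<integral>\<^sup>+X. U X + V X + ennreal (- m X) \<partial>samples n)"
    by (rule nn_integral_mono_AE[OF summed])
  also have "\<dots> = (\<integral>\<^sup>+X. U X \<partial>samples n) + (\<integral>\<^sup>+X. V X \<partial>samples n) + ennreal r2"
    by (simp add: nn_integral_add r2)
  also have "\<dots> \<le> 1 + ennreal (\<gamma> - \<rho>) + ennreal r2"
    by (intro add_mono EU EV order_refl)
  also have "\<dots> = ennreal (1 + (\<gamma> - \<rho>) + r2)"
    using \<rho> \<gamma> r2(2) by (simp only: ennreal_plus ennreal_1[symmetric] add_nonneg_nonneg zero_le_one diff_ge_0_iff_ge)
  finally have total: "(\<integral>\<^sup>+X. F X \<partial>samples n) + ennreal r1 \<le> ennreal (1 + (\<gamma> - \<rho>) + r2)" .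
  then have "(\<integral>\<^sup>+X. F X \<partial>samples n) < \<top>"
    by (metis ennreal_less_top ennreal_add_eq_top less_top top.extremum_unique order_le_less_trans)
  then obtain f where f: "0 \<le> f" "(\<integral>\<^sup>+X. F X \<partial>samples n) = ennreal f"
    by (cases "\<integral>\<^sup>+X. F X \<partial>samples n") auto
  have "ennreal (f + r1) \<le> ennreal (1 + (\<gamma> - \<rho>) + r2)"
    using total f(2) ennreal_plus[OF f(1) r1(2)] by (simp only:)
  then have "f + r1 \<le> 1 + (\<gamma> - \<rho>) + r2"
    using r2(2) \<rho> \<gamma> by (subst (asm) ennreal_le_iff) auto
  then have "f \<le> 1 + (\<gamma> - \<rho>) - (\<integral>X. m X \<partial>samples n)" unfolding r12 by simp
  also have "(\<integral>X. m X \<partial>samples n) = 1 + \<gamma> - \<rho> + \<gamma> * (\<integral>X. ln (enn2real (s X)) \<partial>samples n) - (\<gamma> - \<rho>) * ln a"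
    unfolding m_def using ln_ev by (simp add: s_def S.prob_space)
  finally have "f \<le> (\<gamma> - \<rho>) * ln a - \<gamma> * (\<integral>X. ln (enn2real (s X)) \<partial>samples n)" by simp
  then show ?thesis
    using f by (simp add: F_def[symmetric] w_def[symmetric] s_def[symmetric])
qed

end

section \<open>Divergences from the true density\<close>

lemma powr_le_tangent_at_one:
  fixes y \<rho> :: real
  assumes "0 \<le> y" "0 < \<rho>" "\<rho> < 1"
  shows "y powr \<rho> \<le> 1 + \<rho> * (y - 1)"
proof (cases "y = 0")
  case False
  then show ?thesis
    using Youngs_inequality_0[of \<rho> "1 - \<rho>" y 1] assms by (simp add: algebra_simps)
qed (use assms in simp)

locale true_density =
  fixes \<mu> :: "'a measure" and q :: "'a \<Rightarrow> real"
  assumes q: "prob_density \<mu> q"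
begin

abbreviation Q :: "'a measure" where
  "Q \<equiv> density \<mu> (\<lambda>x. ennreal (q x))"

lemma q_measurable[measurable]: "q \<in> borel_measurable \<mu>"
  and q_nonneg: "x \<in> space \<mu> \<Longrightarrow> 0 \<le> q x"
  using q by (auto simp: prob_density_def)

lemma prob_space_Q: "prob_space Q"
  using q by (intro prob_spaceI) (simp add: emeasure_density prob_density_def cong: nn_integral_cong)

lemma q_pos_AE: "AE x in Q. 0 < q x"
  by (subst AE_density) (auto simp: ennreal_eq_0_iff not_le)

lemma ratio_measurable:
  assumes "prob_density \<mu> f"
  shows "(\<lambda>x. f x / q x) \<in> borel_measurable Q"
proof -
  have [measurable]: "f \<in> borel_measurable \<mu>" using assms by (simp add: prob_density_def)
  show ?thesis by measurable
qed

lemma ratio_nonneg: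
  assumes "prob_density \<mu> f" "x \<in> space Q"
  shows "0 \<le> f x / q x"
  using assms q_nonneg by (simp add: prob_density_def)

lemma ratio_mass:
  assumes f: "prob_density \<mu> f"
  shows "(\<integral>\<^sup>+x. ennreal (f x / q x) \<partial>Q) \<le> 1"
proof -
  have [measurable]: "f \<in> borel_measurable \<mu>" using f by (simp add: prob_density_def)
  have "(\<integral>\<^sup>+x. ennreal (f x / q x) \<partial>Q) = (\<integral>\<^sup>+x. ennreal (q x) * ennreal (f x / q x) \<partial>\<mu>)"
    by (subst nn_integral_density) auto
  also have "\<dots> \<le> (\<integral>\<^sup>+x. ennreal (f x) \<partial>\<mu>)"
    using f q_nonneg
    by (intro nn_integral_mono) (auto simp: prob_density_def ennreal_mult'[symmetric] intro!: ennreal_leI)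
  finally show ?thesis using f by (simp add: prob_density_def)
qed

lemma ratio_integrable:
  assumes f: "prob_density \<mu> f"
  shows "integrable Q (\<lambda>x. f x / q x)" and "(\<integral>x. f x / q x \<partial>Q) \<le> 1"
proof -
  show "integrable Q (\<lambda>x. f x / q x)"
    using ratio_measurable[OF f] ratio_nonneg[OF f] ratio_mass[OF f]
    by (intro integrableI_nonneg) (auto intro: le_less_trans[OF _ ennreal_one_less_top])
  have "(\<integral>x. f x / q x \<partial>Q) = enn2real (\<integral>\<^sup>+x. ennreal (f x / q x) \<partial>Q)"
    using ratio_measurable[OF f] ratio_nonneg[OF f] by (intro integral_eq_nn_integral) auto
  also have "\<dots> \<le> enn2real 1" using ratio_mass[OF f] by (intro enn2real_mono) auto
  finally show "(\<integral>x. f x / q x \<partial>Q) \<le> 1" by simp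
qed

text \<open>The negative part of \<open>ln (q / f)\<close> is at most \<open>f / q\<close> and hence has finite mean; so a finite divergence
  forces the positive part to be integrable too.\<close>

lemma KL_div_finite:
  assumes f: "prob_density \<mu> f" and fin: "KL_div \<mu> q f < \<infinity>"
  shows "AE x in Q. 0 < f x / q x"
    and "integrable Q (\<lambda>x. ln (f x / q x))"
    and "KL_div \<mu> q f = ereal (- (\<integral>x. ln (f x / q x) \<partial>Q))"
proof -
  note [measurable] = ratio_measurable[OF f]
  define g where "g x = f x / q x" for x
  have [measurable]: "g \<in> borel_measurable Q" using ratio_measurable[OF f] by (simp add: g_def[abs_def])
  define I where "I = (\<integral>\<^sup>+x. (if 0 < g x then ennreal (- ln (g x)) else \<top>) \<partial>Q)"
  define N where "N = (\<integral>\<^sup>+x. (if 0 < g x then ennreal (ln (g x)) else 0) \<partial>Q)"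
  have log_ratio: "AE x in Q. ln_ennreal (ennreal (q x) / ennreal (f x)) = (if 0 < g x then ereal (- ln (g x)) else \<infinity>)"
    using q_pos_AE AE_space
  proof eventually_elim
    case (elim x)
    then have "0 \<le> f x" using f by (simp add: prob_density_def)
    then show ?case
      using elim by (cases "f x = 0") (auto simp: g_def ln_ennreal_def divide_ennreal ln_div)
  qed
  have "(\<integral>\<^sup>+x. e2ennreal (ln_ennreal (ennreal (q x) / ennreal (f x))) \<partial>Q) = I"
    unfolding I_def using log_ratio
    by (intro nn_integral_cong_AE) (auto elim!: eventually_mono simp: ennreal.abs_eq[symmetric] e2ennreal_ereal)
  moreover have "(\<integral>\<^sup>+x. e2ennreal (- ln_ennreal (ennreal (q x) / ennreal (f x))) \<partial>Q) = N"
    unfolding N_def using log_ratio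
    by (intro nn_integral_cong_AE) (auto elim!: eventually_mono simp: e2ennreal_neg)
  ultimately have KL: "KL_div \<mu> q f = enn2ereal I - enn2ereal N"
    by (simp add: KL_div_def expect_def)
  have "N \<le> (\<integral>\<^sup>+x. ennreal (g x) \<partial>Q)"
    unfolding N_def by (intro nn_integral_mono) (auto intro!: ennreal_leI order_trans[OF ln_le_minus_one])
  then have "N \<le> 1" using ratio_mass[OF f] by (simp add: g_def)
  then have N: "N < \<top>" using ennreal_one_less_top le_less_trans by blast
  then have I: "I < \<top>" using fin KL by (cases I; cases N) (auto simp: less_top)
  have "AE x in Q. (if 0 < g x then ennreal (- ln (g x)) else \<top>) \<noteq> \<infinity>"
    using I unfolding I_def by (intro nn_integral_PInf_AE) (auto simp: less_top)
  then have pos: "AE x in Q. 0 < g x" by eventually_elim (auto split: if_splits)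
  have IN: "I = (\<integral>\<^sup>+x. ennreal (- ln (g x)) \<partial>Q)" "N = (\<integral>\<^sup>+x. ennreal (ln (g x)) \<partial>Q)"
    unfolding I_def N_def using pos by (auto intro!: nn_integral_cong_AE elim!: eventually_mono)
  have int: "integrable Q (\<lambda>x. ln (g x))"
    using I N unfolding IN real_integrable_def by (auto simp: less_top)
  show "AE x in Q. 0 < f x / q x" "integrable Q (\<lambda>x. ln (f x / q x))"
    using pos int by (auto simp: g_def)
  have "(\<integral>x. ln (g x) \<partial>Q) = enn2real N - enn2real I"
    unfolding IN by (rule real_lebesgue_integral_def[OF int])
  then show "KL_div \<mu> q f = ereal (- (\<integral>x. ln (f x / q x) \<partial>Q))"
    using I N KL by (cases I; cases N) (auto simp: g_def)
qed

lemma KL_div_nonneg: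
  assumes f: "prob_density \<mu> f"
  shows "0 \<le> KL_div \<mu> q f"
proof (cases "KL_div \<mu> q f < \<infinity>")
  case True
  interpret Q: prob_space Q by (rule prob_space_Q)
  note KL = KL_div_finite[OF f True]
  have "(\<integral>x. ln (f x / q x) \<partial>Q) \<le> (\<integral>x. f x / q x - 1 \<partial>Q)"
  proof (rule integral_mono_AE)
    show "AE x in Q. ln (f x / q x) \<le> f x / q x - 1"
      using KL(1) by eventually_elim (rule ln_le_minus_one)
  qed (use KL(2) ratio_integrable[OF f] in auto)
  also have "\<dots> \<le> 0" using ratio_integrable[OF f] by (simp add: Q.prob_space[simplified])
  finally show ?thesis by (simp add: KL(3))
qed simp

lemma affinity_le_one:
  assumes f: "prob_density \<mu> f" and \<rho>: "0 < \<rho>" "\<rho> < 1"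
  shows "integrable Q (\<lambda>x. (f x / q x) powr \<rho>)"
    and "(\<integral>x. (f x / q x) powr \<rho> \<partial>Q) \<le> 1"
proof -
  interpret Q: prob_space Q by (rule prob_space_Q)
  show int: "integrable Q (\<lambda>x. (f x / q x) powr \<rho>)"
    using ratio_integrable(1)[OF f] ratio_nonneg[OF f] \<rho>
    by (intro integrable_powr Q.finite_measure_axioms AE_I2)
  have "(\<integral>x. (f x / q x) powr \<rho> \<partial>Q) \<le> (\<integral>x. 1 + \<rho> * (f x / q x - 1) \<partial>Q)"
    using int ratio_integrable[OF f] ratio_nonneg[OF f] \<rho>
    by (intro integral_mono powr_le_tangent_at_one) auto
  also have "\<dots> = 1 + \<rho> * ((\<integral>x. f x / q x \<partial>Q) - 1)"
    using ratio_integrable(1)[OF f] by (simp add: Q.prob_space[simplified])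
  also have "\<dots> \<le> 1" using ratio_integrable(2)[OF f] \<rho> by (simp add: mult_le_0_iff)
  finally show "(\<integral>x. (f x / q x) powr \<rho> \<partial>Q) \<le> 1" .
qed

lemma renyi_div_eq:
  assumes f: "prob_density \<mu> f" and \<rho>: "0 < \<rho>" "\<rho> < 1"
  defines "F \<equiv> \<integral>x. (f x / q x) powr \<rho> \<partial>Q"
  shows "renyi_div \<rho> \<mu> q f = (if F = 0 then \<infinity> else ereal (- ln F / (\<rho> * (1 - \<rho>))))"
proof -
  have F0: "0 \<le> F" unfolding F_def by (intro integral_nonneg_AE AE_I2) simp
  have "(\<integral>\<^sup>+x. ennreal ((f x / q x) powr \<rho>) \<partial>Q) = ennreal F"
    unfolding F_def using affinity_le_one(1)[OF f \<rho>] by (intro nn_integral_eq_integral) auto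
  moreover have "0 < \<rho> * (1 - \<rho>)" using \<rho> by simp
  ultimately show ?thesis
    using F0 by (auto simp: renyi_div_def ln_ennreal_def)
qed

lemma renyi_div_nonneg:
  assumes f: "prob_density \<mu> f" and \<rho>: "0 < \<rho>" "\<rho> < 1"
  shows "0 \<le> renyi_div \<rho> \<mu> q f"
proof -
  define F where "F = (\<integral>x. (f x / q x) powr \<rho> \<partial>Q)"
  have "0 \<le> F" unfolding F_def by (intro integral_nonneg_AE AE_I2) simp
  then have "0 \<le> - ln F / (\<rho> * (1 - \<rho>))" if "F \<noteq> 0"
    using affinity_le_one(2)[OF f \<rho>] \<rho> that
    by (intro divide_nonneg_pos) (auto simp: F_def[symmetric])
  then show ?thesis by (simp add: renyi_div_eq[OF f \<rho>] F_def[symmetric])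
qed

text \<open>Inverts the definition of the divergence; an infinite lower bound forces the affinity to be zero.\<close>

lemma affinity_le_of_le_renyi_div:
  assumes f: "prob_density \<mu> f" and \<rho>: "0 < \<rho>" "\<rho> < 1" and D: "0 \<le> D" "D \<le> renyi_div \<rho> \<mu> q f"
  shows "(\<integral>x. (f x / q x) powr \<rho> \<partial>Q)
    \<le> (if D = \<infinity> then 0 else exp (- (\<rho> * (1 - \<rho>) * real_of_ereal D)))"
proof -
  define F where "F = (\<integral>x. (f x / q x) powr \<rho> \<partial>Q)"
  have F0: "0 \<le> F" unfolding F_def by (intro integral_nonneg_AE AE_I2) simp
  have r: "0 < \<rho> * (1 - \<rho>)" using \<rho> by simp
  show ?thesis
  proof (cases "F = 0")
    case False
    then have "0 < F" using F0 by simp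
    have le: "D \<le> ereal (- ln F / (\<rho> * (1 - \<rho>)))"
      using D(2) False by (simp add: renyi_div_eq[OF f \<rho>] F_def)
    then obtain d where d: "D = ereal d" using D(1) by (cases D) auto
    have "\<rho> * (1 - \<rho>) * d \<le> - ln F" using le r by (simp add: d field_simps)
    then have "exp (ln F) \<le> exp (- (\<rho> * (1 - \<rho>) * d))" by (subst exp_le_cancel_iff) linarith
    then have "F \<le> exp (- (\<rho> * (1 - \<rho>) * d))" using \<open>0 < F\<close> by simp
    then show ?thesis by (simp add: d F_def)
  qed (simp add: F_def[symmetric])
qed

lemma convex_prob_density: "convex {f. prob_density \<mu> f}"
proof (rule convexI)
  fix f g :: "'a \<Rightarrow> real" and u v :: real
  assume "f \<in> {f. prob_density \<mu> f}" "g \<in> {f. prob_density \<mu> f}" and uv: "0 \<le> u" "0 \<le> v" "u + v = 1"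
  then have f: "prob_density \<mu> f" and g: "prob_density \<mu> g" by auto
  have [measurable]: "f \<in> borel_measurable \<mu>" "g \<in> borel_measurable \<mu>"
    using f g by (auto simp: prob_density_def)
  have "(\<integral>\<^sup>+x. ennreal (u * f x + v * g x) \<partial>\<mu>)
      = (\<integral>\<^sup>+x. ennreal u * ennreal (f x) + ennreal v * ennreal (g x) \<partial>\<mu>)"
    using f g uv by (intro nn_integral_cong) (auto simp: prob_density_def ennreal_mult)
  also have "\<dots> = ennreal u + ennreal v"
    using f g by (simp add: nn_integral_add nn_integral_cmult prob_density_def)
  also have "\<dots> = 1" using uv by (simp add: ennreal_plus[symmetric] del: ennreal_plus)
  finally show "u *\<^sub>R f + v *\<^sub>R g \<in> {f. prob_density \<mu> f}"
    using f g uv by (auto simp: prob_density_def scaleR_fun_def plus_fun_def)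
qed

lemma convex_hull_prob_density:
  assumes "\<And>\<theta>. \<theta> \<in> A \<Longrightarrow> prob_density \<mu> (p \<theta>)" "f \<in> convex hull (p ` A)"
  shows "prob_density \<mu> f"
proof -
  have "convex hull (p ` A) \<subseteq> {f. prob_density \<mu> f}"
    using assms(1) by (intro hull_minimal convex_prob_density) auto
  then show ?thesis using assms(2) by blast
qed

end

section \<open>Likelihood ratios of a Bayesian model\<close>

locale bayes_model = true_density \<mu> q for \<mu> :: "'a measure" and q +
  fixes \<pi> :: "'t measure" and p :: "'t \<Rightarrow> 'a \<Rightarrow> real"
  assumes prior_prob: "prob_space \<pi>"
    and p: "\<And>\<theta>. \<theta> \<in> space \<pi> \<Longrightarrow> prob_density \<mu> (p \<theta>)"
    and p_measurable: "(\<lambda>(\<theta>, x). p \<theta> x) \<in> borel_measurable (\<pi> \<Otimes>\<^sub>M \<mu>)"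

sublocale bayes_model \<subseteq> L: likelihood_ratios Q \<pi> "\<lambda>\<theta> x. p \<theta> x / q x"
proof (rule likelihood_ratios.intro)
  show "prob_space Q" by (rule prob_space_Q)
  show "prob_space \<pi>" by (rule prior_prob)
  have [measurable]: "(\<lambda>z. p (fst z) (snd z)) \<in> borel_measurable (\<pi> \<Otimes>\<^sub>M \<mu>)"
    using p_measurable by (simp add: case_prod_unfold)
  have "(\<lambda>(\<theta>, x). p \<theta> x / q x) \<in> borel_measurable (\<pi> \<Otimes>\<^sub>M \<mu>)"
    by (simp add: case_prod_unfold)
  then show "(\<lambda>(\<theta>, x). p \<theta> x / q x) \<in> borel_measurable (\<pi> \<Otimes>\<^sub>M Q)"
    by (subst measurable_cong_sets[OF sets_pair_measure_cong refl]) auto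
  show "0 \<le> p \<theta> x / q x" if "\<theta> \<in> space \<pi>" "x \<in> space Q" for \<theta> x
    by (rule ratio_nonneg[OF p[OF that(1)] that(2)])
  show "(\<integral>\<^sup>+x. ennreal (p \<theta> x / q x) \<partial>Q) \<le> 1" if "\<theta> \<in> space \<pi>" for \<theta>
    by (rule ratio_mass[OF p[OF that]])
qed

context bayes_model
begin

lemma sample_law_eq: "sample_law n \<mu> q = L.samples n"
  by (simp add: sample_law_def)

text \<open>Passing from densities to likelihood ratios multiplies all likelihoods by the common factor
  \<open>1 / \<Prod>\<^sub>i q(X\<^sub>i)\<close>, which is neither zero nor infinite for almost every sample. Posterior
  probabilities do not see it.\<close>

lemma likelihood_factor_AE:
  "AE X in L.samples n. \<exists>Z. Z \<noteq> 0 \<and> Z \<noteq> \<top> \<and> (\<forall>A\<in>sets \<pi>.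
    (\<integral>\<^sup>+\<theta>\<in>A. likelihood n p \<theta> X \<partial>\<pi>) = Z * L.evidence n A X)"
proof -
  have "AE X in L.samples n. \<forall>i\<in>{..<n}. 0 < q (X i)"
    using q_pos_AE L.Q
    by (intro AE_finite_allI) (auto intro!: AE_PiM_component[where M="\<lambda>_. Q" and P="\<lambda>x. 0 < q x"])
  then show ?thesis
    using AE_space
  proof eventually_elim
    case (elim X)
    define Z where "Z = (\<Prod>i<n. ennreal (q (X i)))"
    have Xi: "X i \<in> space \<mu>" if "i < n" for i using elim(2) that by (auto simp: space_PiM)
    have lik: "likelihood n p \<theta> X = Z * likelihood n (\<lambda>\<theta> x. p \<theta> x / q x) \<theta> X"
      if "\<theta> \<in> space \<pi>" for \<theta>
      unfolding likelihood_def Z_def prod.distrib[symmetric]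
    proof (rule prod.cong[OF refl])
      fix i assume "i \<in> {..<n}"
      then have "0 < q (X i)" "0 \<le> p \<theta> (X i)"
        using elim(1) Xi p[OF that] by (auto simp: prob_density_def)
      then show "ennreal (p \<theta> (X i)) = ennreal (q (X i)) * ennreal (p \<theta> (X i) / q (X i))"
        by (simp add: ennreal_mult[symmetric])
    qed
    have "Z \<noteq> 0" using elim(1) by (auto simp: Z_def ennreal_eq_0_iff not_le)
    moreover have "Z \<noteq> \<top>" by (auto simp: Z_def ennreal_prod_eq_top)
    moreover have "(\<integral>\<^sup>+\<theta>\<in>A. likelihood n p \<theta> X \<partial>\<pi>) = Z * L.evidence n A X" if [measurable]: "A \<in> sets \<pi>" for A
    proof -
      have "(\<integral>\<^sup>+\<theta>\<in>A. likelihood n p \<theta> X \<partial>\<pi>)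
          = (\<integral>\<^sup>+\<theta>. Z * (likelihood n (\<lambda>\<theta> x. p \<theta> x / q x) \<theta> X * indicator A \<theta>) \<partial>\<pi>)"
        by (intro nn_integral_cong) (simp add: lik mult.assoc)
      also have "\<dots> = Z * L.evidence n A X"
        unfolding L.evidence_def using elim(2) by (intro nn_integral_cmult) measurable
      finally show ?thesis .
    qed
    ultimately show ?case by blast
  qed
qed

lemma posterior_eq_AE:
  "AE X in L.samples n. \<forall>A\<in>sets \<pi>. posterior n p \<pi> A X = L.evidence n A X / L.evidence n (space \<pi>) X"
  using likelihood_factor_AE[of n]
proof eventually_elim
  case (elim X)
  then obtain Z where Z: "Z \<noteq> 0" "Z \<noteq> \<top>"
    and eq: "\<And>A. A \<in> sets \<pi> \<Longrightarrow> (\<integral>\<^sup>+\<theta>\<in>A. likelihood n p \<theta> X \<partial>\<pi>) = Z * L.evidence n A X"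
    by blast
  have "(\<integral>\<^sup>+\<theta>. likelihood n p \<theta> X \<partial>\<pi>) = Z * L.evidence n (space \<pi>) X"
    unfolding eq[OF sets.top, symmetric] by (intro nn_integral_cong) simp
  then show ?case
    using eq Z by (simp add: posterior_def divide_mult_eq mult.commute[of Z])
qed

lemma evidence_pos_AE:
  assumes "AE X in L.samples n. 0 < (\<integral>\<^sup>+\<theta>. likelihood n p \<theta> X \<partial>\<pi>)"
  shows "AE X in L.samples n. 0 < L.evidence n (space \<pi>) X"
  using assms likelihood_factor_AE[of n]
proof eventually_elim
  case (elim X)
  then obtain Z where "(\<integral>\<^sup>+\<theta>\<in>space \<pi>. likelihood n p \<theta> X \<partial>\<pi>) = Z * L.evidence n (space \<pi>) X"
    by blast
  moreover have "(\<integral>\<^sup>+\<theta>\<in>space \<pi>. likelihood n p \<theta> X \<partial>\<pi>) = (\<integral>\<^sup>+\<theta>. likelihood n p \<theta> X \<partial>\<pi>)"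
    by (intro nn_integral_cong) simp
  ultimately show ?case using elim(1) by (auto simp: ennreal_zero_less_mult_iff)
qed

text \<open>The set \<open>C\<close> to which the mixture bound is applied is the convex hull of the densities of the
  cell, divided by \<open>q\<close>.\<close>

lemma evidence_le_exp_renyi:
  fixes \<rho> :: real
  assumes A: "A \<in> sets \<pi>" "A \<noteq> {}" and \<rho>: "0 < \<rho>" "\<rho> < 1"
  defines "D \<equiv> INF f\<in>convex hull (p ` A). renyi_div \<rho> \<mu> q f"
  shows "(\<integral>\<^sup>+X. ennreal (enn2real (L.evidence n A X) powr \<rho>) \<partial>L.samples n)
    \<le> ennreal (measure \<pi> A powr \<rho> * (if D = \<infinity> then 0 else exp (- (\<rho> * (1 - \<rho>) * real_of_ereal D))) ^ n)"
proof -
  have pA: "prob_density \<mu> (p \<theta>)" if "\<theta> \<in> A" for \<theta>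
    using p sets.sets_into_space[OF A(1)] that by blast
  have co: "prob_density \<mu> f" if "f \<in> convex hull (p ` A)" for f
    by (rule convex_hull_prob_density[OF pA that])
  have D0: "0 \<le> D" unfolding D_def by (intro INF_greatest renyi_div_nonneg[OF co \<rho>])
  show ?thesis
  proof (rule L.evidence_affinity_le[where C="(\<lambda>f x. f x / q x) ` (convex hull (p ` A))"])
    show "(\<lambda>f x. f x / q x) ` (convex hull (p ` A)) \<noteq> {}" using A(2) by simp
    show "integrable Q f" if "f \<in> (\<lambda>f x. f x / q x) ` (convex hull (p ` A))" for f
      using that ratio_integrable(1)[OF co] by auto
    show "0 \<le> f x" if "f \<in> (\<lambda>f x. f x / q x) ` (convex hull (p ` A))" "x \<in> space Q" for f x
      using that ratio_nonneg[OF co] by auto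
    show "(\<integral>x. f x powr \<rho> \<partial>Q) \<le> (if D = \<infinity> then 0 else exp (- (\<rho> * (1 - \<rho>) * real_of_ereal D)))"
      if f: "f \<in> (\<lambda>f x. f x / q x) ` (convex hull (p ` A))" for f
    proof -
      obtain f' where f': "f' \<in> convex hull (p ` A)" "f = (\<lambda>x. f' x / q x)" using f by blast
      have "D \<le> renyi_div \<rho> \<mu> q f'" unfolding D_def using f'(1) by (rule INF_lower)
      from affinity_le_of_le_renyi_div[OF co[OF f'(1)] \<rho> D0 this] show ?thesis by (simp add: f'(2))
    qed
    show "\<exists>g\<in>(\<lambda>f x. f x / q x) ` (convex hull (p ` A)).
        \<forall>x\<in>space Q. g x = (1 - t) * f x + t * (p \<theta> x / q x)"
      if f: "f \<in> (\<lambda>f x. f x / q x) ` (convex hull (p ` A))" and \<theta>: "\<theta> \<in> A" and t: "0 < t" "t < 1" for f \<theta> t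
    proof -
      obtain f' where f': "f' \<in> convex hull (p ` A)" "f = (\<lambda>x. f' x / q x)" using f by blast
      have "(1 - t) *\<^sub>R f' + t *\<^sub>R p \<theta> \<in> convex hull (p ` A)"
        using f'(1) hull_inc[of "p \<theta>" "p ` A" convex] \<theta> t
        by (intro convexD[OF convex_convex_hull]) auto
      then show ?thesis
        by (rule bexI[OF _ imageI, rotated])
          (simp add: f'(2) scaleR_fun_def plus_fun_def add_divide_distrib)
    qed
  qed (use A \<rho> in auto)
qed

text \<open>The Gibbs principle is applied with \<open>k\<close> constant on each cell, equal to the supremum \<open>K\<close> of the
  divergence over the convex hull, which bounds the divergence of every density of the cell. Cells with
  infinite \<open>K\<close> contribute nothing to \<open>B\<close> and are left out of \<open>T\<close>.\<close>

lemma expected_log_evidence_ge_KL: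
  assumes J: "countable J" and \<Gamma>: "\<And>j. j \<in> J \<Longrightarrow> \<Gamma> j \<in> sets \<pi>"
    and disj: "disjoint_family_on \<Gamma> J" and cover: "(\<Union>j\<in>J. \<Gamma> j) = space \<pi>"
    and n: "1 \<le> n"
    and ev: "AE X in L.samples n. 0 < L.evidence n (space \<pi>) X"
  defines "B \<equiv> \<integral>\<^sup>+j. emeasure \<pi> (\<Gamma> j) *
      exp_ereal (- (ereal (real n) * (SUP f\<in>convex hull (p ` \<Gamma> j). KL_div \<mu> q f))) \<partial>count_space J"
  assumes B: "B \<noteq> 0"
  shows "\<exists>b>0. B = ennreal b
    \<and> integrable (L.samples n) (\<lambda>X. ln (enn2real (L.evidence n (space \<pi>) X)))
    \<and> ln b \<le> (\<integral>X. ln (enn2real (L.evidence n (space \<pi>) X)) \<partial>L.samples n)"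
proof -
  define K where "K j = (SUP f\<in>convex hull (p ` \<Gamma> j). KL_div \<mu> q f)" for j
  define cell where "cell \<theta> = (THE j. j \<in> J \<and> \<theta> \<in> \<Gamma> j)" for \<theta>
  have cell: "cell \<theta> = j" if "j \<in> J" "\<theta> \<in> \<Gamma> j" for \<theta> j
    unfolding cell_def using that disj unfolding disjoint_family_on_def by (intro the_equality) blast+
  have \<Gamma>_space: "\<theta> \<in> space \<pi>" if "j \<in> J" "\<theta> \<in> \<Gamma> j" for \<theta> j using cover that by blast
  have cell_in: "cell \<theta> \<in> J" "\<theta> \<in> \<Gamma> (cell \<theta>)" if "\<theta> \<in> space \<pi>" for \<theta>
    using that cell cover by blast+
  have cell_meas: "cell \<in> measurable \<pi> (count_space J)"
  proof (subst measurable_count_space_eq_countable[OF J], intro conjI ballI)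
    fix j assume j: "j \<in> J"
    have "cell -` {j} \<inter> space \<pi> = \<Gamma> j" using cell[OF j] cell_in \<Gamma>_space[OF j] by blast
    then show "cell -` {j} \<inter> space \<pi> \<in> sets \<pi>" using \<Gamma>[OF j] by simp
  qed (use cell_in in auto)
  define k where "k \<theta> = real_of_ereal (K (cell \<theta>))" for \<theta>
  have [measurable]: "k \<in> borel_measurable \<pi>"
    unfolding k_def[abs_def] by (rule measurable_compose[OF cell_meas]) simp
  define T where "T = cell -` {j\<in>J. K j \<noteq> \<infinity>} \<inter> space \<pi>"
  have T[measurable]: "T \<in> sets \<pi>"
    unfolding T_def by (rule measurable_sets[OF cell_meas]) auto
  have K_upper: "KL_div \<mu> q (p \<theta>) \<le> K j" if "j \<in> J" "\<theta> \<in> \<Gamma> j" for j \<theta>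
    unfolding K_def using that(2) by (intro SUP_upper hull_inc) auto
  have K_nonneg: "0 \<le> K j" if "j \<in> J" "\<theta> \<in> \<Gamma> j" for j \<theta>
    using K_upper[OF that] KL_div_nonneg[OF p[OF \<Gamma>_space[OF that]]] by order
  have K_real: "K (cell \<theta>) = ereal (k \<theta>)" "0 \<le> k \<theta>" if "\<theta> \<in> T" for \<theta>
  proof -
    have \<theta>: "\<theta> \<in> space \<pi>" "K (cell \<theta>) \<noteq> \<infinity>" using that by (auto simp: T_def)
    then show "K (cell \<theta>) = ereal (k \<theta>)" "0 \<le> k \<theta>"
      using K_nonneg[OF cell_in[OF \<theta>(1)]] by (cases "K (cell \<theta>)"; simp add: k_def)+
  qed
  have KL: "AE x in Q. 0 < p \<theta> x / q x" "integrable Q (\<lambda>x. ln (p \<theta> x / q x))"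
    "- k \<theta> \<le> (\<integral>x. ln (p \<theta> x / q x) \<partial>Q)" if \<theta>: "\<theta> \<in> T" for \<theta>
  proof -
    have s: "\<theta> \<in> space \<pi>" using \<theta> by (simp add: T_def)
    have le: "KL_div \<mu> q (p \<theta>) \<le> ereal (k \<theta>)"
      using K_upper[OF cell_in[OF s]] K_real[OF \<theta>] by simp
    then have "KL_div \<mu> q (p \<theta>) < \<infinity>" by (rule le_less_trans) simp
    note KL = KL_div_finite[OF p[OF s] this]
    show "AE x in Q. 0 < p \<theta> x / q x" "integrable Q (\<lambda>x. ln (p \<theta> x / q x))" by (fact KL)+
    show "- k \<theta> \<le> (\<integral>x. ln (p \<theta> x / q x) \<partial>Q)" using le KL(3) by simp
  qed
  define W where "W \<theta> = ennreal (exp (- (real n * k \<theta>))) * indicator T \<theta>" for \<theta>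
  have [measurable]: "W \<in> borel_measurable \<pi>" unfolding W_def[abs_def] by measurable
  have BW: "B = (\<integral>\<^sup>+\<theta>. W \<theta> \<partial>\<pi>)"
  proof -
    have "B = (\<integral>\<^sup>+j. (\<integral>\<^sup>+\<theta>\<in>\<Gamma> j. W \<theta> \<partial>\<pi>) \<partial>count_space J)"
      unfolding B_def K_def[symmetric]
    proof (rule nn_integral_cong)
      fix j assume "j \<in> space (count_space J)"
      then have j: "j \<in> J" by simp
      have "(\<integral>\<^sup>+\<theta>\<in>\<Gamma> j. W \<theta> \<partial>\<pi>) = (\<integral>\<^sup>+\<theta>. exp_ereal (- (ereal (real n) * K j)) * indicator (\<Gamma> j) \<theta> \<partial>\<pi>)"
      proof (rule nn_integral_cong)
        fix \<theta> assume s: "\<theta> \<in> space \<pi>"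
        show "W \<theta> * indicator (\<Gamma> j) \<theta> = exp_ereal (- (ereal (real n) * K j)) * indicator (\<Gamma> j) \<theta>"
        proof (cases "\<theta> \<in> \<Gamma> j")
          case True
          note c = cell[OF j True]
          show ?thesis
          proof (cases "K j = \<infinity>")
            case inf: True
            then show ?thesis using True c n by (simp add: W_def T_def exp_ereal_def)
          next
            case False
            then have "\<theta> \<in> T" using c s j by (simp add: T_def)
            then show ?thesis using K_real[of \<theta>] c True by (simp add: W_def exp_ereal_def)
          qed
        qed simp
      qed
      also have "\<dots> = exp_ereal (- (ereal (real n) * K j)) * emeasure \<pi> (\<Gamma> j)"
        using \<Gamma>[OF j] by (rule nn_integral_cmult_indicator)
      finally show "emeasure \<pi> (\<Gamma> j) * exp_ereal (- (ereal (real n) * K j)) = (\<integral>\<^sup>+\<theta>\<in>\<Gamma> j. W \<theta> \<partial>\<pi>)"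
        by (simp add: mult.commute)
    qed
    also have "\<dots> = (\<integral>\<^sup>+\<theta>. W \<theta> \<partial>\<pi>)" by (rule nn_integral_partition[OF J \<Gamma> disj cover]) measurable
    finally show ?thesis .
  qed
  also have "\<dots> \<le> (\<integral>\<^sup>+\<theta>. 1 \<partial>\<pi>)"
    using K_real(2) by (intro nn_integral_mono) (auto simp: W_def indicator_def intro!: ennreal_leI)
  finally have "B \<le> 1" by (simp add: L.prior.emeasure_space_1)
  then have "B < \<top>" using ennreal_one_less_top le_less_trans by blast
  then obtain b where b: "0 < b" "B = ennreal b"
    using B by (cases B) (auto simp: less_le ennreal_eq_0_iff)
  note * = L.expected_log_evidence_ge[OF n T _ K_real(2) KL ev, of b]
  have "(\<integral>\<^sup>+\<theta>\<in>T. ennreal (exp (- (real n * k \<theta>))) \<partial>\<pi>) = ennreal b"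
    using BW b by (simp add: W_def)
  then show ?thesis using *(1) *(2) b by (intro exI[of _ b]) auto
qed

end

section \<open>The posterior bound\<close>

lemma infsum_ennreal_eq_nn_integral:
  fixes f :: "'j \<Rightarrow> ennreal"
  assumes J: "countable J"
  shows "(\<Sum>\<^sub>\<infinity>j\<in>J. f j) = (\<integral>\<^sup>+j. f j \<partial>count_space J)"
proof (cases "finite J")
  case True
  then show ?thesis by (simp add: nn_integral_count_space_finite)
next
  case False
  note bij = bij_betw_from_nat_into[OF J False]
  have "(\<Sum>\<^sub>\<infinity>j\<in>J. f j) = (\<Sum>\<^sub>\<infinity>i. f (from_nat_into J i))"
    by (rule infsum_reindex_bij_betw[OF bij, symmetric])
  also have "\<dots> = (\<Sum>i. f (from_nat_into J i))"
    by (intro sums_unique has_sum_imp_sums has_sum_infsum nonneg_summable_on_complete) simp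
  also have "\<dots> = (\<integral>\<^sup>+j. f j \<partial>count_space J)"
    by (simp add: nn_integral_bij_count_space[OF bij, symmetric] nn_integral_count_space_nat)
  finally show ?thesis .
qed

lemma infsum_enn2ereal:
  fixes f :: "'j \<Rightarrow> ennreal"
  assumes "countable J"
  shows "(\<Sum>\<^sub>\<infinity>j\<in>J. enn2ereal (f j)) = enn2ereal (\<integral>\<^sup>+j. f j \<partial>count_space J)"
proof -
  have "infsum (enn2ereal \<circ> f) J = enn2ereal (infsum f J)"
    by (rule infsum_comm_additive_general)
      (auto simp: continuous_at_enn2ereal nonneg_summable_on_complete)
  then show ?thesis using infsum_ennreal_eq_nn_integral[OF assms, of f] by (simp add: comp_def)
qed

lemma expect_of_nonneg:
  assumes "AE x in M. f x = enn2ereal (g x)"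
  shows "expect M f = enn2ereal (\<integral>\<^sup>+x. g x \<partial>M)"
proof -
  have "(\<integral>\<^sup>+x. e2ennreal (f x) \<partial>M) = (\<integral>\<^sup>+x. g x \<partial>M)"
    using assms by (intro nn_integral_cong_AE) (auto elim!: eventually_mono)
  moreover have "(\<integral>\<^sup>+x. e2ennreal (- f x) \<partial>M) = (\<integral>\<^sup>+x. 0 \<partial>M)"
    using assms by (intro nn_integral_cong_AE) (auto elim!: eventually_mono intro!: e2ennreal_neg)
  ultimately show ?thesis by (simp add: expect_def zero_ennreal.rep_eq)
qed

theorem theorem5p3:
  fixes \<mu> :: "'a measure"
    and q :: "'a \<Rightarrow> real"
    and p :: "'t \<Rightarrow> 'a \<Rightarrow> real"
    and \<pi> :: "'t measure"
    and \<Gamma> :: "'j \<Rightarrow> 't set"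
    and J :: "'j set"
    and n :: nat
    and \<rho> \<gamma> :: real
  assumes q: "prob_density \<mu> q"
    and prior: "prob_space \<pi>"
    and p: "\<And>\<theta>. \<theta> \<in> space \<pi> \<Longrightarrow> prob_density \<mu> (p \<theta>)"
    and p_measurable: "(\<lambda>(\<theta>, x). p \<theta> x) \<in> borel_measurable (\<pi> \<Otimes>\<^sub>M \<mu>)"
    and partition: "countable J" "\<And>j. j \<in> J \<Longrightarrow> \<Gamma> j \<in> sets \<pi>"
      "disjoint_family_on \<Gamma> J" "(\<Union>j\<in>J. \<Gamma> j) = space \<pi>"
    and n: "1 \<le> n"
    and posterior_well_defined: "AE X in sample_law n \<mu> q.
      0 < (\<integral>\<^sup>+\<theta>. likelihood n p \<theta> X \<partial>\<pi>) \<and> (\<integral>\<^sup>+\<theta>. likelihood n p \<theta> X \<partial>\<pi>) < \<top>"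
    and \<rho>: "0 < \<rho>" "\<rho> < 1"
    and \<gamma>: "1 \<le> \<gamma>"
  shows "expect (sample_law n \<mu> q)
      (\<lambda>X. \<Sum>\<^sub>\<infinity>j\<in>J. enn2ereal (posterior n p \<pi> (\<Gamma> j) X) *
         (INF f\<in>convex hull (p ` \<Gamma> j). renyi_div \<rho> \<mu> q f))
    \<le> (ereal (\<gamma> - \<rho>) *
          ln_ennreal (\<Sum>\<^sub>\<infinity>j\<in>J. ennreal (measure \<pi> (\<Gamma> j) powr ((\<gamma> - 1) / (\<gamma> - \<rho>))))
       - ereal \<gamma> *
          ln_ennreal (\<Sum>\<^sub>\<infinity>j\<in>J. emeasure \<pi> (\<Gamma> j) *
            exp_ereal (- (ereal (real n) * (SUP f\<in>convex hull (p ` \<Gamma> j). KL_div \<mu> q f)))))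
      / ereal (\<rho> * (1 - \<rho>) * real n)"
proof -
  interpret bayes_model \<mu> q \<pi> p
    by (intro bayes_model.intro true_density.intro bayes_model_axioms.intro) (fact q prior p p_measurable)+
  define D where "D j = (INF f\<in>convex hull (p ` \<Gamma> j). renyi_div \<rho> \<mu> q f)" for j
  define A where "A = (\<integral>\<^sup>+j. ennreal (measure \<pi> (\<Gamma> j) powr ((\<gamma> - 1) / (\<gamma> - \<rho>))) \<partial>count_space J)"
  define B where "B = (\<integral>\<^sup>+j. emeasure \<pi> (\<Gamma> j) *
      exp_ereal (- (ereal (real n) * (SUP f\<in>convex hull (p ` \<Gamma> j). KL_div \<mu> q f))) \<partial>count_space J)"
  define R where "R = \<rho> * (1 - \<rho>) * real n"
  have R: "0 < R" using \<rho> n by (simp add: R_def)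
  have ev: "AE X in L.samples n. 0 < L.evidence n (space \<pi>) X"
    by (rule evidence_pos_AE, rule eventually_mono[OF posterior_well_defined[unfolded sample_law_eq]]) blast
  have D0: "0 \<le> D j" if "j \<in> J" for j
    unfolding D_def
  proof (rule INF_greatest)
    fix f assume f: "f \<in> convex hull (p ` \<Gamma> j)"
    have pj: "prob_density \<mu> (p \<theta>)" if "\<theta> \<in> \<Gamma> j" for \<theta>
      using p partition(4) \<open>j \<in> J\<close> that by blast
    show "0 \<le> renyi_div \<rho> \<mu> q f"
      by (rule renyi_div_nonneg[OF convex_hull_prob_density[OF pj f] \<rho>])
  qed
  define \<delta> where "\<delta> j = e2ennreal (D j)" for j
  have \<delta>: "D j = enn2ereal (\<delta> j)" if "j \<in> J" for j
    using D0[OF that] by (simp add: \<delta>_def enn2ereal_e2ennreal)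
  define w where "w j X = L.evidence n (\<Gamma> j) X / L.evidence n (space \<pi>) X" for j X
  define I where "I = (\<integral>\<^sup>+X. (\<integral>\<^sup>+j. w j X * \<delta> j \<partial>count_space J) \<partial>L.samples n)"
  have lhs: "expect (sample_law n \<mu> q) (\<lambda>X. \<Sum>\<^sub>\<infinity>j\<in>J. enn2ereal (posterior n p \<pi> (\<Gamma> j) X) * D j)
      = enn2ereal I"
    unfolding sample_law_eq I_def
  proof (rule expect_of_nonneg)
    show "AE X in L.samples n. (\<Sum>\<^sub>\<infinity>j\<in>J. enn2ereal (posterior n p \<pi> (\<Gamma> j) X) * D j)
        = enn2ereal (\<integral>\<^sup>+j. w j X * \<delta> j \<partial>count_space J)"
      using posterior_eq_AE[of n]
    proof eventually_elim
      case (elim X)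
      have "(\<Sum>\<^sub>\<infinity>j\<in>J. enn2ereal (posterior n p \<pi> (\<Gamma> j) X) * D j) = (\<Sum>\<^sub>\<infinity>j\<in>J. enn2ereal (w j X * \<delta> j))"
        using elim partition(2) by (intro infsum_cong) (simp add: \<delta> w_def times_ennreal.rep_eq)
      then show ?case by (simp add: infsum_enn2ereal[OF partition(1)])
    qed
  qed
  have "enn2ereal I \<le> (ereal (\<gamma> - \<rho>) * ln_ennreal A - ereal \<gamma> * ln_ennreal B) / ereal R"
  \<comment> \<open>In these two cases the right-hand side is infinite.\<close>
  proof (cases "A = \<top> \<or> B = 0")
    case True
    then have "ereal (\<gamma> - \<rho>) * ln_ennreal A - ereal \<gamma> * ln_ennreal B = \<infinity>"
    proof
      assume "A = \<top>"
      then show ?thesis using \<rho> \<gamma> by (simp add: ln_ennreal_def)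
    next
      assume "B = 0"
      then show ?thesis using \<gamma>
        by (cases "ereal (\<gamma> - \<rho>) * ln_ennreal A") (simp_all add: ln_ennreal_def)
    qed
    then show ?thesis using R by simp
  next
    case False
    obtain b where b: "0 < b" "B = ennreal b"
      and ln_int: "integrable (L.samples n) (\<lambda>X. ln (enn2real (L.evidence n (space \<pi>) X)))"
      and ln_ge: "ln b \<le> (\<integral>X. ln (enn2real (L.evidence n (space \<pi>) X)) \<partial>L.samples n)"
      using expected_log_evidence_ge_KL[OF partition n ev, folded B_def] False by blast
    have "A \<noteq> 0"
    proof
      assume "A = 0"
      then have "emeasure \<pi> (\<Gamma> j) = 0" if "j \<in> J" for j
        using that unfolding A_def
        by (subst (asm) nn_integral_0_iff_AE)
          (auto simp: AE_count_space L.prior.emeasure_eq_measure ennreal_eq_0_iff powr_eq_0_iff not_less)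
      then have "B = (\<integral>\<^sup>+j. 0 \<partial>count_space J)" unfolding B_def by (intro nn_integral_cong) simp
      then show False using False by simp
    qed
    then obtain a where a: "0 < a" "A = ennreal a"
      using False by (cases A) (auto simp: less_le)
    define c where "c j = ennreal R * \<delta> j" for j
    have affinity: "(\<integral>\<^sup>+X. ennreal (enn2real (L.evidence n (\<Gamma> j) X) powr \<rho>) \<partial>L.samples n)
        \<le> (if c j = \<top> then 0 else ennreal (measure \<pi> (\<Gamma> j) powr \<rho> * exp (- enn2real (c j))))"
      if j: "j \<in> J" for j
    proof (cases "\<Gamma> j = {}")
      case True
      then show ?thesis by (simp add: L.evidence_def)
    next
      case False
      note bound = evidence_le_exp_renyi[OF partition(2)[OF j] False \<rho>, of n, folded D_def]
      have c_top: "c j = \<top> \<longleftrightarrow> D j = \<infinity>"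
        using R \<delta>[OF j] by (cases "\<delta> j") (auto simp: c_def ennreal_mult_eq_top_iff ennreal_mult[symmetric])
      show ?thesis
      proof (cases "D j = \<infinity>")
        case True
        then show ?thesis using bound n c_top by (simp add: power_0_left)
      next
        case fin: False
        then obtain d where d: "0 \<le> d" "D j = ereal d" using D0[OF j] by (cases "D j") auto
        then have "c j = ennreal (R * d)"
          using R by (simp add: c_def \<delta>_def e2ennreal_ereal ennreal_mult)
        moreover have "exp (- (\<rho> * (1 - \<rho>) * d)) ^ n = exp (- (R * d))"
          by (simp add: exp_of_nat_mult[symmetric] R_def algebra_simps)
        ultimately show ?thesis using bound d R by simp
      qed
    qed
    have "ennreal R * I = (\<integral>\<^sup>+X. (\<integral>\<^sup>+j. w j X * c j \<partial>count_space J) \<partial>L.samples n)"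
    proof -
      have w_meas: "w j \<in> borel_measurable (L.samples n)" if "j \<in> J" for j
        unfolding w_def[abs_def] using L.evidence_measurable[OF partition(2)[OF that]]
          L.evidence_measurable[OF sets.top] by measurable
      have "ennreal R * I = (\<integral>\<^sup>+X. ennreal R * (\<integral>\<^sup>+j. w j X * \<delta> j \<partial>count_space J) \<partial>L.samples n)"
        unfolding I_def using w_meas
        by (intro nn_integral_cmult[symmetric] borel_measurable_nn_integral_count_space partition(1)) auto
      also have "\<dots> = (\<integral>\<^sup>+X. (\<integral>\<^sup>+j. w j X * c j \<partial>count_space J) \<partial>L.samples n)"
        by (intro nn_integral_cong, subst nn_integral_cmult[symmetric])
          (auto simp: c_def mult_ac intro!: nn_integral_cong)
      finally show ?thesis .
    qed
    moreover have "enn2ereal (\<integral>\<^sup>+X. (\<integral>\<^sup>+j. w j X * c j \<partial>count_space J) \<partial>L.samples n)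
        \<le> ereal ((\<gamma> - \<rho>) * ln a - \<gamma> * (\<integral>X. ln (enn2real (L.evidence n (space \<pi>) X)) \<partial>L.samples n))"
      unfolding w_def
    proof (rule L.expected_posterior_cost_le[OF partition \<rho> \<gamma> ev ln_int])
      show "(\<integral>\<^sup>+X. ennreal (enn2real (L.evidence n (\<Gamma> j) X) powr \<rho>) \<partial>L.samples n)
          \<le> ennreal (measure \<pi> (\<Gamma> j) powr \<rho> * exp (- enn2real (c j)))" if "j \<in> J" "c j < \<top>" for j
        using affinity[OF that(1)] that(2) by (auto split: if_splits)
      show "AE X in L.samples n. L.evidence n (\<Gamma> j) X = 0" if j: "j \<in> J" and top: "c j = \<top>" for j
      proof -
        note [measurable] = L.evidence_measurable[OF partition(2)[OF j], of n]
        have "(\<integral>\<^sup>+X. ennreal (enn2real (L.evidence n (\<Gamma> j) X) powr \<rho>) \<partial>L.samples n) = 0"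
          using affinity[OF j] top by simp
        then have "AE X in L.samples n. ennreal (enn2real (L.evidence n (\<Gamma> j) X) powr \<rho>) = 0"
          by (subst (asm) nn_integral_0_iff_AE) auto
        then show ?thesis
          using L.evidence_finite_AE[OF partition(2)[OF j], of n]
          by eventually_elim (auto simp: ennreal_eq_0_iff enn2real_eq_0_iff)
      qed
      show "(\<integral>\<^sup>+j. ennreal (measure \<pi> (\<Gamma> j) powr ((\<gamma> - 1) / (\<gamma> - \<rho>))) \<partial>count_space J) = ennreal a"
        using a(2) by (simp add: A_def)
    qed (use a(1) in auto)
    ultimately have "enn2ereal (ennreal R * I)
        \<le> ereal ((\<gamma> - \<rho>) * ln a - \<gamma> * (\<integral>X. ln (enn2real (L.evidence n (space \<pi>) X)) \<partial>L.samples n))"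
      by simp
    also have "\<dots> \<le> ereal ((\<gamma> - \<rho>) * ln a - \<gamma> * ln b)"
      using ln_ge \<gamma> by simp
    finally have RI: "enn2ereal (ennreal R * I) \<le> ereal ((\<gamma> - \<rho>) * ln a - \<gamma> * ln b)" .
    then obtain i where i: "0 \<le> i" "I = ennreal i"
      using R by (cases I) (auto simp: ennreal_mult_top)
    have "R * i \<le> (\<gamma> - \<rho>) * ln a - \<gamma> * ln b"
      using RI i R by (simp add: ennreal_mult[symmetric])
    then have "i \<le> ((\<gamma> - \<rho>) * ln a - \<gamma> * ln b) / R" using R by (simp add: field_simps)
    then show ?thesis using i a b R by (simp add: ln_ennreal_def)
  qed
  then show ?thesis
    unfolding infsum_ennreal_eq_nn_integral[OF partition(1)] A_def[symmetric] B_def[symmetric]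
      R_def[symmetric] D_def[symmetric] lhs .
qed

end
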